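(* There exists a universal constant $c_0>0$, and for each $\alpha\in(0,1)$ a constant $C>0$ depending only on $\alpha$, such that for all integers $n\ge1$ and all $\epsilon_{\max}\in[0,1]$ with $\frac{\log(2/\alpha)}n+\epsilon_{\max}\le c_0$, the interval $\widehat{\mathrm{CI}}=\{\lambda\in[0,\widehat\lambda_{\max}]:\widehat\psi^+_{\lambda,\epsilon}=\widehat\psi^-_{\lambda,\epsilon}=0\text{ for all }\epsilon\in\mathcal E\}$ defined in the context satisfies $$\inf_{\epsilon\in[0,\epsilon_{\max}],\,\lambda,\,Q}P_{\epsilon,\lambda,Q}\big(\lambda\in\widehat{\mathrm{CI}}\big)\ge1-\alpha,$$ $$\inf_{\epsilon\in[0,\epsilon_{\max}],\,\lambda,\,Q}P_{\epsilon,\lambda,Q}\left(|\widehat{\mathrm{CI}}|\le C\left(\left[\left(\sqrt\lambda\Big(\frac1{\sqrt{\log n}}+\frac1{\sqrt{\log(1/\epsilon)}}\Big)+1\right)\wedge\lambda\right]+\frac1n+\epsilon\right)\right)\ge1-\alpha.$$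
   Context: For $\epsilon\in[0,1]$, $\lambda\ge0$ and a probability distribution $Q$ on $\mathbb R$ put $P_{\epsilon,\lambda,Q}=(1-\epsilon)\,\mathrm{Poisson}(\lambda)+\epsilon Q$. The data $X_1,\dots,X_n$ are i.i.d. from $P_{\epsilon,\lambda,Q}$, and $P_{\epsilon,\lambda,Q}(E)$ denotes the probability of an event $E$ about $(X_1,\dots,X_n)$ under $P_{\epsilon,\lambda,Q}^{\otimes n}$. Infima over $Q$ range over all probability distributions, over $\lambda$ over $[0,\infty)$. Write $a\wedge b=\min\{a,b\}$, $\mathbb N=\{1,2,\dots\}$, $\mathbb N_0=\mathbb N\cup\{0\}$. $|\cdot|$ denotes the length of an interval (the empty interval has length $0$). Conventions: $1/\sqrt{\log(1/\epsilon)}=0$ for $\epsilon=0$; a minimum of binary variables over an empty index set equals $1$. Let $A=\epsilon+\sqrt{\log(24/\alpha)/(2n)}$ and define for $\lambda\ge0$: - $\overline t(\lambda,\epsilon)=\lambda-\min\{\frac\lambda2,\frac18\sqrt{\lambda\log(1/A)}\}$. - $\overline r(\lambda,\epsilon)=\frac12$ for $\lambda=0$; $\overline r(\lambda,\epsilon)=\frac{\lambda}{4(\lambda-\overline t(\lambda,\epsilon))}$ for $\lambda>0$. - $\overline\tau(\lambda,\epsilon)=\frac{11}{10}\mathbb P(\mathrm{Poisson}(\lambda+\overline r(\lambda,\epsilon))\le\overline t(\lambda,\epsilon))$. - $\underline t(\lambda,\epsilon)=1$ for $\lambda\in[0,1)$; $\underline t(\lambda,\epsilon)=\lambda+\min\{\frac\lambda2,\frac18\sqrt{\lambda\log(1/A)}\}$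 for $\lambda\ge1$. - $\underline r(\lambda,\epsilon)=(1-\frac1{6e})\lambda$ for $\lambda\in[0,1)$; $\underline r(\lambda,\epsilon)=\frac{\lambda}{4(\underline t(\lambda,\epsilon)-\lambda)}$ for $\lambda\ge1$. - $\underline\tau(\lambda,\epsilon)=\frac12(1-e^{-\lambda})-\frac{3\log(24/\alpha)}n$ for $\lambda\in[0,1)$; $\underline\tau(\lambda,\epsilon)=\frac{11}{10}\mathbb P(\mathrm{Poisson}(\lambda-\underline r(\lambda,\epsilon))\ge\underline t(\lambda,\epsilon))$ for $\lambda\ge1$. - $\phi^+_{\lambda,\epsilon}=\mathbf 1\{\frac1n\sum_{i=1}^n\mathbf 1\{X_i\le\overline t(\lambda,\epsilon)\}<\overline\tau(\lambda,\epsilon)\}$, $\ \phi^-_{\lambda,\epsilon}=\mathbf 1\{\frac1n\sum_{i=1}^n\mathbf 1\{X_i\ge\underline t(\lambda,\epsilon)\}<\underline\tau(\lambda,\epsilon)\}$. Let $\widehat\lambda_{\max}=X_{(\lceil3n/4\rceil)}+1$, where $X_{(k)}$ is the $k$-th smallest observation, and define - $\widehat\psi^+_{\lambda,\epsilon}=\min_{\mu\in[0,\lceil\lambda\rceil]\cap\mathbb N_0}\phi^+_{\mu,\epsilon}$ for $\lambda\in[0,\widehat\lambda_{\max})$, and $\widehat\psi^+_{\lambda,\epsilon}=0$ for $\lambda=\widehat\lambda_{\max}$; - $\widehat\psi^-_{\lambda,\epsilon}=\phi^-_{\lambda,\epsilon}\wedge\min_{\mu\in[1,\widehat\lambda_{\max}]\cap\mathbb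 N}\phi^-_{\mu,\epsilon}$ for $\lambda\in[0,1)$, and $\widehat\psi^-_{\lambda,\epsilon}=\min_{\mu\in[\lfloor\lambda\rfloor,\widehat\lambda_{\max}]\cap\mathbb N}\phi^-_{\mu,\epsilon}$ for $\lambda\in[1,\widehat\lambda_{\max}]$. Grid: $\mathcal E=\Big\{\frac{2^k\log(24/\alpha)}n:k=0,1,\dots,\big\lfloor\log_2\big(\tfrac{n\epsilon_{\max}}{\log(24/\alpha)}\big)\big\rfloor\Big\}\cup\{\epsilon_{\max}\}$ (the first set is empty if the upper limit for $k$ is negative or $\epsilon_{\max}=0$). *)

theory Defs
  imports "HOL-Probability.Probability"
begin

text \<open>The library's \<^const>\<open>poisson_pmf\<close> is characterised for positive rates only; here
  \<open>Poisson(0)\<close> is the point mass at \<open>0\<close>. It is only used for rates \<open>\<ge> 0\<close>.\<close>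

definition poisson :: "real \<Rightarrow> nat pmf" where
  "poisson lam = (if lam = 0 then return_pmf 0 else poisson_pmf lam)"

lemma pmf_poisson_nonneg: "lam \<ge> 0 \<Longrightarrow> pmf (poisson lam) k = lam ^ k / fact k * exp (- lam)"
  by (cases k) (auto simp: poisson_def)

definition contaminated_poisson :: "real \<Rightarrow> real \<Rightarrow> real measure \<Rightarrow> real measure" where
  "contaminated_poisson \<epsilon> lam Q =
     measure_of UNIV (sets borel)
       (\<lambda>B. ennreal (1 - \<epsilon>) * emeasure (distr (measure_pmf (poisson lam)) borel real) B
            + ennreal \<epsilon> * emeasure Q B)"

lemma sets_contaminated_poisson [simp, measurable_cong]:
  "sets (contaminated_poisson \<epsilon> lam Q) = sets borel"
  using sets.sigma_sets_eq[of borel] by (simp add: contaminated_poisson_def)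

lemma space_contaminated_poisson [simp]: "space (contaminated_poisson \<epsilon> lam Q) = UNIV"
  using sets_eq_imp_space_eq[OF sets_contaminated_poisson] by simp

lemma emeasure_contaminated_poisson:
  assumes Q: "sets Q = sets borel" and B: "B \<in> sets borel"
  shows "emeasure (contaminated_poisson \<epsilon> lam Q) B =
     ennreal (1 - \<epsilon>) * emeasure (distr (measure_pmf (poisson lam)) borel real) B
       + ennreal \<epsilon> * emeasure Q B"
proof (rule emeasure_measure_of[OF contaminated_poisson_def])
  let ?R = "distr (measure_pmf (poisson lam)) borel real"
  let ?f = "\<lambda>B. ennreal (1 - \<epsilon>) * emeasure ?R B + ennreal \<epsilon> * emeasure Q B"
  show "positive (sets (contaminated_poisson \<epsilon> lam Q)) ?f"
    by (simp add: positive_def)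
  show "countably_additive (sets (contaminated_poisson \<epsilon> lam Q)) ?f"
  proof (rule countably_additiveI)
    fix A :: "nat \<Rightarrow> real set"
    assume A: "range A \<subseteq> sets (contaminated_poisson \<epsilon> lam Q)" "disjoint_family A"
    have R: "(\<Sum>i. emeasure ?R (A i)) = emeasure ?R (\<Union>i. A i)"
      using A by (intro suminf_emeasure) auto
    have Q': "(\<Sum>i. emeasure Q (A i)) = emeasure Q (\<Union>i. A i)"
      using A Q by (intro suminf_emeasure) auto
    have "(\<Sum>i. ?f (A i)) = (\<Sum>i. ennreal (1 - \<epsilon>) * emeasure ?R (A i))
        + (\<Sum>i. ennreal \<epsilon> * emeasure Q (A i))"
      by (rule suminf_add[symmetric]) auto
    then show "(\<Sum>i. ?f (A i)) = ?f (\<Union>i. A i)"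
      by (simp add: ennreal_suminf_cmult R Q')
  qed
qed (use B in auto)

lemma prob_space_contaminated_poisson:
  assumes "\<epsilon> \<in> {0..1}" "prob_space Q" "sets Q = sets borel"
  shows "prob_space (contaminated_poisson \<epsilon> lam Q)"
proof (rule prob_spaceI)
  interpret R: prob_space "distr (measure_pmf (poisson lam)) borel real"
    by (rule prob_space.prob_space_distr) (auto simp: measure_pmf.prob_space_axioms)
  interpret Q: prob_space Q by fact
  have "space Q = UNIV" using sets_eq_imp_space_eq[OF assms(3)] by simp
  with Q.emeasure_space_1 have "emeasure Q UNIV = 1" by simp
  moreover have "emeasure (distr (measure_pmf (poisson lam)) borel real) UNIV = 1"
    using R.emeasure_space_1 by simp
  ultimately show "emeasure (contaminated_poisson \<epsilon> lam Q) (space (contaminated_poisson \<epsilon> lam Q)) = 1"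
    using assms by (simp add: emeasure_contaminated_poisson flip: ennreal_plus)
qed

definition sample_law :: "nat \<Rightarrow> real \<Rightarrow> real \<Rightarrow> real measure \<Rightarrow> (nat \<Rightarrow> real) measure" where
  "sample_law n \<epsilon> lam Q = Pi\<^sub>M {1..n} (\<lambda>_. contaminated_poisson \<epsilon> lam Q)"

definition prob_distributions :: "real measure set" where
  "prob_distributions = {Q. prob_space Q \<and> sets Q = sets borel}"

definition A_lev :: "real \<Rightarrow> nat \<Rightarrow> real \<Rightarrow> real" where
  "A_lev \<alpha> n \<epsilon> = \<epsilon> + sqrt (ln (24 / \<alpha>) / (2 * real n))"

definition t_shift :: "real \<Rightarrow> nat \<Rightarrow> real \<Rightarrow> real \<Rightarrow> real" where
  "t_shift \<alpha> n lam \<epsilon> = min (lam / 2) (1 / 8 * sqrt (lam * ln (1 / A_lev \<alpha> n \<epsilon>)))"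

definition t_over :: "real \<Rightarrow> nat \<Rightarrow> real \<Rightarrow> real \<Rightarrow> real" where
  "t_over \<alpha> n lam \<epsilon> = lam - t_shift \<alpha> n lam \<epsilon>"

definition r_over :: "real \<Rightarrow> nat \<Rightarrow> real \<Rightarrow> real \<Rightarrow> real" where
  "r_over \<alpha> n lam \<epsilon> =
     (if lam = 0 then 1 / 2 else lam / (4 * (lam - t_over \<alpha> n lam \<epsilon>)))"

definition tau_over :: "real \<Rightarrow> nat \<Rightarrow> real \<Rightarrow> real \<Rightarrow> real" where
  "tau_over \<alpha> n lam \<epsilon> =
     11 / 10 * measure_pmf.prob (poisson (lam + r_over \<alpha> n lam \<epsilon>)) {k. real k \<le> t_over \<alpha> n lam \<epsilon>}"

definition t_under :: "real \<Rightarrow> nat \<Rightarrow> real \<Rightarrow> real \<Rightarrow> real" where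
  "t_under \<alpha> n lam \<epsilon> = (if lam < 1 then 1 else lam + t_shift \<alpha> n lam \<epsilon>)"

definition r_under :: "real \<Rightarrow> nat \<Rightarrow> real \<Rightarrow> real \<Rightarrow> real" where
  "r_under \<alpha> n lam \<epsilon> =
     (if lam < 1 then (1 - 1 / (6 * exp 1)) * lam
      else lam / (4 * (t_under \<alpha> n lam \<epsilon> - lam)))"

definition tau_under :: "real \<Rightarrow> nat \<Rightarrow> real \<Rightarrow> real \<Rightarrow> real" where
  "tau_under \<alpha> n lam \<epsilon> =
     (if lam < 1 then 1 / 2 * (1 - exp (- lam)) - 3 * ln (24 / \<alpha>) / real n
      else 11 / 10 * measure_pmf.prob (poisson (lam - r_under \<alpha> n lam \<epsilon>))
             {k. t_under \<alpha> n lam \<epsilon> \<le> real k})"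

definition phi_plus :: "real \<Rightarrow> nat \<Rightarrow> (nat \<Rightarrow> real) \<Rightarrow> real \<Rightarrow> real \<Rightarrow> nat" where
  "phi_plus \<alpha> n X lam \<epsilon> =
     of_bool (1 / real n * (\<Sum>i=1..n. of_bool (X i \<le> t_over \<alpha> n lam \<epsilon>)) < tau_over \<alpha> n lam \<epsilon>)"

definition phi_minus :: "real \<Rightarrow> nat \<Rightarrow> (nat \<Rightarrow> real) \<Rightarrow> real \<Rightarrow> real \<Rightarrow> nat" where
  "phi_minus \<alpha> n X lam \<epsilon> =
     of_bool (1 / real n * (\<Sum>i=1..n. of_bool (X i \<ge> t_under \<alpha> n lam \<epsilon>)) < tau_under \<alpha> n lam \<epsilon>)"

definition order_statistic :: "nat \<Rightarrow> (nat \<Rightarrow> real) \<Rightarrow> nat \<Rightarrow> real" where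
  "order_statistic n X k = sort (map X [1..<Suc n]) ! (k - 1)"

definition lam_max :: "nat \<Rightarrow> (nat \<Rightarrow> real) \<Rightarrow> real" where
  "lam_max n X = order_statistic n X (nat \<lceil>3 * real n / 4\<rceil>) + 1"

definition binary_min :: "nat set \<Rightarrow> (nat \<Rightarrow> nat) \<Rightarrow> nat" where
  "binary_min S f = (if S = {} then 1 else Min (f ` S))"

lemma binary_min_eq_0_iff:
  assumes "finite S"
  shows "binary_min S f = 0 \<longleftrightarrow> (\<exists>\<mu>\<in>S. f \<mu> = 0)"
proof (cases "S = {}")
  case False
  have "Min (f ` S) = 0 \<longleftrightarrow> Min (f ` S) \<le> 0" by simp
  also have "\<dots> \<longleftrightarrow> (\<exists>\<mu>\<in>S. f \<mu> \<le> 0)"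
    using assms False by (subst Min_le_iff) auto
  finally show ?thesis using False by (simp add: binary_min_def)
qed (simp add: binary_min_def)

text \<open>Both statistics are only used for \<open>0 \<le> lam \<le> lam_max n X\<close>.\<close>

definition psi_plus :: "real \<Rightarrow> nat \<Rightarrow> (nat \<Rightarrow> real) \<Rightarrow> real \<Rightarrow> real \<Rightarrow> nat" where
  "psi_plus \<alpha> n X lam \<epsilon> =
     (if lam < lam_max n X
      then binary_min {\<mu>. int \<mu> \<le> \<lceil>lam\<rceil>} (\<lambda>\<mu>. phi_plus \<alpha> n X (real \<mu>) \<epsilon>)
      else 0)"

definition psi_minus :: "real \<Rightarrow> nat \<Rightarrow> (nat \<Rightarrow> real) \<Rightarrow> real \<Rightarrow> real \<Rightarrow> nat" where
  "psi_minus \<alpha> n X lam \<epsilon> =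
     (if lam < 1
      then min (phi_minus \<alpha> n X lam \<epsilon>)
             (binary_min {\<mu>. 1 \<le> \<mu> \<and> real \<mu> \<le> lam_max n X} (\<lambda>\<mu>. phi_minus \<alpha> n X (real \<mu>) \<epsilon>))
      else binary_min {\<mu>. 1 \<le> \<mu> \<and> \<lfloor>lam\<rfloor> \<le> int \<mu> \<and> real \<mu> \<le> lam_max n X}
             (\<lambda>\<mu>. phi_minus \<alpha> n X (real \<mu>) \<epsilon>))"

definition eps_grid :: "real \<Rightarrow> nat \<Rightarrow> real \<Rightarrow> real set" where
  "eps_grid \<alpha> n \<epsilon>max =
     {2 ^ k * ln (24 / \<alpha>) / real n | k :: nat.
        \<epsilon>max \<noteq> 0 \<and> int k \<le> \<lfloor>log 2 (real n * \<epsilon>max / ln (24 / \<alpha>))\<rfloor>} \<union> {\<epsilon>max}"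

definition CI_hat :: "real \<Rightarrow> nat \<Rightarrow> real \<Rightarrow> (nat \<Rightarrow> real) \<Rightarrow> real set" where
  "CI_hat \<alpha> n \<epsilon>max X =
     {lam \<in> {0..lam_max n X}.
        \<forall>\<epsilon>\<in>eps_grid \<alpha> n \<epsilon>max. psi_plus \<alpha> n X lam \<epsilon> = 0 \<and> psi_minus \<alpha> n X lam \<epsilon> = 0}"

lemma finite_nat_le_int: "finite {\<mu>. int \<mu> \<le> z}"
  by (rule finite_subset[of _ "{..nat z}"]) auto

lemma finite_nat_le_real: "finite {\<mu>. P \<mu> \<and> real \<mu> \<le> x}"
  by (rule finite_subset[of _ "{..nat \<lfloor>x\<rfloor>}"]) (auto simp: le_nat_iff le_floor_iff)

lemma is_interval_CI_hat: "is_interval (CI_hat \<alpha> n \<epsilon>max X)"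
proof -
  have plus: "psi_plus \<alpha> n X y \<epsilon> = 0" if "psi_plus \<alpha> n X x \<epsilon> = 0" "x \<le> y" for x y \<epsilon>
  proof (cases "y < lam_max n X")
    case True
    with that obtain \<mu> where "int \<mu> \<le> \<lceil>x\<rceil>" "phi_plus \<alpha> n X (real \<mu>) \<epsilon> = 0"
      by (auto simp: psi_plus_def binary_min_eq_0_iff finite_nat_le_int)
    moreover have "\<lceil>x\<rceil> \<le> \<lceil>y\<rceil>" using that by (simp add: ceiling_mono)
    ultimately show ?thesis using True
      by (auto simp: psi_plus_def binary_min_eq_0_iff finite_nat_le_int intro!: exI[of _ \<mu>])
  qed (simp add: psi_plus_def)
  have phi: "phi_minus \<alpha> n X x \<epsilon> = 0"
    if "phi_minus \<alpha> n X y \<epsilon> = 0" "x \<le> y" "y < 1" for x y \<epsilon>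
  proof -
    have "tau_under \<alpha> n x \<epsilon> \<le> tau_under \<alpha> n y \<epsilon>"
      using that by (simp add: tau_under_def)
    then show ?thesis using that by (auto simp: phi_minus_def t_under_def)
  qed
  have minus: "psi_minus \<alpha> n X x \<epsilon> = 0" if y: "psi_minus \<alpha> n X y \<epsilon> = 0" "x \<le> y" for x y \<epsilon>
  proof -
    have psi0: "psi_minus \<alpha> n X z \<epsilon> = 0 \<longleftrightarrow> (z < 1 \<and> phi_minus \<alpha> n X z \<epsilon> = 0) \<or>
        (\<exists>\<mu>\<ge>1. (z < 1 \<or> \<lfloor>z\<rfloor> \<le> int \<mu>) \<and> real \<mu> \<le> lam_max n X \<and> phi_minus \<alpha> n X (real \<mu>) \<epsilon> = 0)" for z
    proof -
      have "min (a :: nat) b = 0 \<longleftrightarrow> a = 0 \<or> b = 0" for a b by (auto simp: min_def)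
      moreover have "finite {\<mu>. 1 \<le> \<mu> \<and> \<lfloor>z\<rfloor> \<le> int \<mu> \<and> real \<mu> \<le> lam_max n X}"
        using finite_nat_le_real[of "\<lambda>\<mu>. 1 \<le> \<mu> \<and> \<lfloor>z\<rfloor> \<le> int \<mu>"] by (simp add: conj_assoc)
      ultimately show ?thesis
        by (auto simp: psi_minus_def binary_min_eq_0_iff finite_nat_le_real)
    qed
    have xy: "\<lfloor>x\<rfloor> \<le> \<lfloor>y\<rfloor>" using y by (simp add: floor_mono)
    from y(1)[unfolded psi0] show ?thesis
    proof (elim disjE exE conjE)
      assume "y < 1" "phi_minus \<alpha> n X y \<epsilon> = 0"
      with y phi[of y \<epsilon> x] show ?thesis by (simp add: psi0)
    next
      fix \<mu> assume \<mu>: "1 \<le> \<mu>" "real \<mu> \<le> lam_max n X" "phi_minus \<alpha> n X (real \<mu>) \<epsilon> = 0"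
      { assume "y < 1"
        with y have "x < 1" by simp
        with \<mu> show ?thesis unfolding psi0 by (intro disjI2 exI[of _ \<mu>]) simp }
      { assume "\<lfloor>y\<rfloor> \<le> int \<mu>"
        with xy have "\<lfloor>x\<rfloor> \<le> int \<mu>" by (rule order_trans)
        with \<mu> show ?thesis unfolding psi0 by (intro disjI2 exI[of _ \<mu>]) simp }
    qed
  qed
  show ?thesis
    unfolding is_interval_1 CI_hat_def by (auto intro: plus minus)
qed

text \<open>On bounded intervals this is the usual length; \<open>is_interval_CI_hat\<close> shows that it is
  applied to an interval.\<close>

definition interval_length :: "real set \<Rightarrow> real" where
  "interval_length S = (if S = {} then 0 else Sup S - Inf S)"

definition inv_sqrt_log :: "real \<Rightarrow> real" where
  "inv_sqrt_log \<epsilon> = (if \<epsilon> = 0 then 0 else 1 / sqrt (ln (1 / \<epsilon>)))"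

text \<open>The library value of \<open>1 / sqrt (ln n)\<close> at \<open>n = 1\<close> plays no role: sample size \<open>1\<close> is excluded
  as soon as \<open>ln (2 / \<alpha>) / n + \<epsilon>max < ln 2\<close>.\<close>

definition length_rate :: "nat \<Rightarrow> real \<Rightarrow> real \<Rightarrow> real" where
  "length_rate n \<epsilon> lam =
     min (sqrt lam * (1 / sqrt (ln (real n)) + inv_sqrt_log \<epsilon>) + 1) lam + 1 / real n + \<epsilon>"

end

theory Submission
  imports Defs
begin

text \<open>The argument takes place on one event on which the empirical frequencies of all rays that the
  tests inspect are uniformly close to their true probabilities, intersected with one Chernoff event
  for rates below \<open>1\<close>.

  \<^emph>\<open>Tails.\<close> With \<open>\<ell> = ln (1 / A)\<close>, the thresholds at \<open>\<mu>\<close> (of \<open>t_under\<close> only for \<open>\<mu> \<ge> 1\<close>) lie at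
  most \<open>sqrt (\<mu> \<ell>) / 8\<close> away from \<open>\<mu>\<close>, so that the Poisson tails defining the critical values are at least \<open>100 sqrt A\<close>
  (\<open>poisson_lower_tail_margin\<close>, \<open>poisson_upper_tail_margin\<close>). The lower bound comes from a change of
  measure with the chi-square identity \<open>pmf_poisson_square\<close>. Conversely, moving the mean \<open>\<mu>\<close>
  away from the threshold \<open>t\<close> by \<open>r = \<mu> / (4 |\<mu> - t|)\<close> multiplies the tail by at most \<open>exp (-1/4) < 4/5\<close>
  (\<open>tau_over_le\<close>, \<open>tau_under_le\<close>), which beats the factor \<open>11/10\<close> in the critical values.

  \<^emph>\<open>Uniform deviation.\<close> Put \<open>L = ln (24 / \<alpha>)\<close>. For a countable chain of events, only about \<open>m\<close> of them
  matter up to an error \<open>1 / m\<close>, and Chernoff's bound with the union bound gives a uniform deviation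
  of at most \<open>2 / m\<close> (\<open>emp_freq_chain_deviation\<close>). This is weaker than the
  Dvoretzky-Kiefer-Wolfowitz inequality but suffices: with \<open>m\<close> of order \<open>(n / L) powr (1/4)\<close> the deviation is at
  most \<open>5 sqrt A\<close>, far below the tails, because \<open>A \<ge> sqrt (L / (2 n))\<close>.

  \<^emph>\<open>Coverage.\<close> Under contamination a ray keeps at least \<open>99/100\<close> of its Poisson probability, so
  the test at \<open>\<lceil>lam\<rceil>\<close> (for \<open>psi_plus\<close>) and the one at \<open>\<lfloor>lam\<rfloor>\<close> (for \<open>psi_minus\<close>, \<open>lam \<ge> 1\<close>) accept at every level,
  also at levels below the true \<open>\<epsilon>\<close>. For \<open>lam < 1\<close> the test of \<open>psi_minus\<close> needs a one-sided
  Chernoff bound at the scale \<open>L / n\<close> for the number of observations that are at least \<open>1\<close>. Finally \<open>lam \<le> lam_max\<close>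
  because a Poisson variable with integer mean \<open>k\<close> is at least \<open>k\<close> with probability at least \<open>1/2\<close>.

  \<^emph>\<open>Length.\<close> Contamination raises the probability of a ray by at most \<open>\<epsilon>\<close>, which is absorbed by the
  tails at any level \<open>e \<ge> \<epsilon>\<close>. Hence at such a level all \<open>\<mu>\<close> with \<open>\<mu> + r \<le> lam\<close> are rejected from below and all
  \<open>\<mu> \<ge> 1\<close> with \<open>lam \<le> \<mu> - r\<close> from above. Since \<open>r \<le> 1/2 + 2 sqrt (\<mu> / \<ell>)\<close>, the interval lies between
  \<open>lam - 2 - 2 sqrt (lam / \<ell>)\<close> and \<open>lam + 2 + 4 sqrt (lam / \<ell>)\<close>, and below \<open>2 lam + 1\<close>. The grid contains a level
  with \<open>\<epsilon> \<le> e \<le> max (2 \<epsilon>) (L / n)\<close>, for which \<open>1 / sqrt \<ell>\<close> is of the claimed order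
  (\<open>inverse_sqrt_log_lev_le\<close>). For \<open>lam < 1\<close> a further Chernoff bound for the observations that are at
  least \<open>1\<close> bounds the right end point by a multiple of \<open>lam + \<epsilon> + 1 / n\<close>.\<close>

section \<open>Poisson probabilities\<close>

lemma measure_pmf_pointwise_le:
  assumes "\<And>k. k \<in> E \<Longrightarrow> pmf p k \<le> c * pmf q k + d * pmf w k"
  shows "measure_pmf.prob p E \<le> c * measure_pmf.prob q E + d * measure_pmf.prob w E"
proof -
  have "infsetsum (pmf p) E \<le> infsetsum (\<lambda>k. c * pmf q k + d * pmf w k) E"
    using assms by (intro infsetsum_mono abs_summable_on_add abs_summable_on_cmult_right
      pmf_abs_summable) auto
  also have "\<dots> = c * infsetsum (pmf q) E + d * infsetsum (pmf w) E"
    by (simp add: infsetsum_add abs_summable_on_cmult_right pmf_abs_summable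
      infsetsum_cmult_right)
  finally show ?thesis by (simp add: measure_pmf_conv_infsetsum)
qed

text \<open>Comparison of two Poisson laws: \<open>1 + d / lam \<le> exp (d / lam)\<close> turns the likelihood ratio into an
  exponential tilt. It bounds the tails in both directions.\<close>

lemma pmf_poisson_tilt:
  assumes "lam > 0" "- lam \<le> d"
  shows "pmf (poisson (lam + d)) k \<le> exp (d * (real k - lam) / lam) * pmf (poisson lam) k"
proof -
  have "(1 + d / lam) ^ k \<le> exp (d / lam) ^ k"
    using assms by (intro power_mono exp_ge_add_one_self) (auto simp: field_simps)
  also have "\<dots> = exp (real k * (d / lam))" by (rule exp_of_nat_mult[symmetric])
  finally have *: "lam ^ k * (1 + d / lam) ^ k \<le> lam ^ k * exp (real k * (d / lam))"
    using assms by (intro mult_left_mono) auto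
  have "lam ^ k * (1 + d / lam) ^ k = (lam + d) ^ k"
    using assms by (simp add: power_mult_distrib[symmetric] field_simps)
  with * have "(lam + d) ^ k * (exp (- (lam + d)) / fact k)
      \<le> lam ^ k * exp (real k * (d / lam)) * (exp (- (lam + d)) / fact k)"
    by (intro mult_right_mono) auto
  moreover have "exp (real k * (d / lam)) * exp (- (lam + d))
      = exp (d * (real k - lam) / lam) * exp (- lam)"
    using assms by (simp flip: exp_add) (simp add: field_simps)
  ultimately show ?thesis
    using assms by (simp add: pmf_poisson_nonneg mult_ac)
qed

lemma poisson_lower_tail_tilt:
  assumes "lam > 0" "0 \<le> r"
  shows "measure_pmf.prob (poisson (lam + r)) {k. real k \<le> t}
      \<le> exp (- (r * (lam - t) / lam)) * measure_pmf.prob (poisson lam) {k. real k \<le> t}"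
proof -
  have "pmf (poisson (lam + r)) k \<le> exp (- (r * (lam - t) / lam)) * pmf (poisson lam) k"
    if "real k \<le> t" for k
  proof -
    have "r * (real k - lam) / lam \<le> r * (t - lam) / lam"
      using assms that by (intro divide_right_mono mult_left_mono) auto
    also have "\<dots> = - (r * (lam - t) / lam)" using assms by (simp add: field_simps)
    finally show ?thesis
      using pmf_poisson_tilt[of lam r k] assms
      by (intro order_trans[OF pmf_poisson_tilt] mult_right_mono) auto
  qed
  then show ?thesis
    using measure_pmf_pointwise_le[of "{k. real k \<le> t}" "poisson (lam + r)" _ "poisson lam" 0 "poisson lam"]
    by auto
qed

lemma poisson_upper_tail_tilt:
  assumes "lam > 0" "0 \<le> r" "r \<le> lam"
  shows "measure_pmf.prob (poisson (lam - r)) {k. t \<le> real k}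
      \<le> exp (- (r * (t - lam) / lam)) * measure_pmf.prob (poisson lam) {k. t \<le> real k}"
proof -
  have "pmf (poisson (lam - r)) k \<le> exp (- (r * (t - lam) / lam)) * pmf (poisson lam) k"
    if "t \<le> real k" for k
  proof -
    have "r * (t - lam) / lam \<le> r * (real k - lam) / lam"
      using assms that by (intro divide_right_mono mult_left_mono) auto
    then have "(- r) * (real k - lam) / lam \<le> - (r * (t - lam) / lam)"
      using assms by (simp add: field_simps)
    then show ?thesis
      using pmf_poisson_tilt[of lam "- r" k] assms
      by (auto intro!: order_trans[OF pmf_poisson_tilt[of lam "- r" k, simplified]] mult_right_mono)
  qed
  then show ?thesis
    using measure_pmf_pointwise_le[of "{k. t \<le> real k}" "poisson (lam - r)" _ "poisson lam" 0 "poisson lam"]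
    by auto
qed

text \<open>The squared density ratio of two Poisson laws is again a Poisson density up to the constant
  \<open>exp ((\<nu> - \<nu>')\<^sup>2 / \<nu>)\<close>, which is one plus their chi-square divergence.\<close>

lemma pmf_poisson_square:
  assumes "\<nu> > 0" "\<nu>' \<ge> 0"
  shows "(pmf (poisson \<nu>') k)\<^sup>2
      = exp ((\<nu> - \<nu>')\<^sup>2 / \<nu>) * pmf (poisson \<nu>) k * pmf (poisson (\<nu>'\<^sup>2 / \<nu>)) k"
proof -
  have "exp ((\<nu> - \<nu>')\<^sup>2 / \<nu>) * exp (- \<nu>) * exp (- (\<nu>'\<^sup>2 / \<nu>)) = exp (- \<nu>') * exp (- \<nu>')"
    using assms by (simp flip: exp_add) (simp add: field_simps power2_eq_square)
  moreover have "\<nu> ^ k * (\<nu>'\<^sup>2 / \<nu>) ^ k = \<nu>' ^ k * \<nu>' ^ k"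
    using assms by (simp flip: power_mult_distrib) (simp add: power2_eq_square)
  ultimately have "(\<nu>' ^ k * \<nu>' ^ k) * (exp (- \<nu>') * exp (- \<nu>')) =
     (\<nu> ^ k * (\<nu>'\<^sup>2 / \<nu>) ^ k) * (exp ((\<nu> - \<nu>')\<^sup>2 / \<nu>) * exp (- \<nu>) * exp (- (\<nu>'\<^sup>2 / \<nu>)))"
    by metis
  then show ?thesis
    using assms by (simp add: pmf_poisson_nonneg power2_eq_square field_simps)
qed

text \<open>An event that is likely under the mean \<open>\<nu>'\<close> keeps a quantifiable probability under \<open>\<nu>\<close>. The proof
  integrates the inequality \<open>sqrt (b w) \<le> b + w / 4\<close>, applied pointwise to the identity above.\<close>

lemma poisson_prob_shift_lower:
  assumes "\<nu> > 0" "\<nu>' \<ge> 0" "1 / 2 \<le> measure_pmf.prob (poisson \<nu>') E"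
  shows "1 / 4 * exp (- ((\<nu> - \<nu>')\<^sup>2 / \<nu>)) \<le> measure_pmf.prob (poisson \<nu>) E"
proof -
  define K where "K = exp ((\<nu> - \<nu>')\<^sup>2 / \<nu>)"
  have "pmf (poisson \<nu>') k \<le> K * pmf (poisson \<nu>) k + 1 / 4 * pmf (poisson (\<nu>'\<^sup>2 / \<nu>)) k" for k
  proof (rule power2_le_imp_le)
    let ?b = "K * pmf (poisson \<nu>) k" and ?w = "pmf (poisson (\<nu>'\<^sup>2 / \<nu>)) k"
    have "(?b + 1 / 4 * ?w)\<^sup>2 = ?b * ?w + (?b - 1 / 4 * ?w)\<^sup>2"
      by (simp add: power2_eq_square algebra_simps)
    then show "(pmf (poisson \<nu>') k)\<^sup>2 \<le> (?b + 1 / 4 * ?w)\<^sup>2"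
      using pmf_poisson_square[OF assms(1,2)] by (simp add: K_def)
  qed (simp add: K_def)
  then have "measure_pmf.prob (poisson \<nu>') E
      \<le> K * measure_pmf.prob (poisson \<nu>) E + 1 / 4 * measure_pmf.prob (poisson (\<nu>'\<^sup>2 / \<nu>)) E"
    by (intro measure_pmf_pointwise_le)
  also have "\<dots> \<le> K * measure_pmf.prob (poisson \<nu>) E + 1 / 4" by simp
  finally have "1 / 4 \<le> K * measure_pmf.prob (poisson \<nu>) E" using assms(3) by linarith
  then show ?thesis by (simp add: K_def exp_minus field_simps)
qed

text \<open>The masses at \<open>k - 1 - j\<close> and at \<open>k + j\<close> are paired: the second is at least the first, because
  \<open>(k - i) (k + i) \<le> k\<^sup>2\<close>.\<close>

lemma poisson_ge_mean_ge_half: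
  assumes "k \<ge> 1"
  shows "1 / 2 \<le> measure_pmf.prob (poisson (real k)) {j. k \<le> j}"
proof -
  let ?p = "pmf (poisson (real k))"
  have rec: "?p (Suc i) = ?p i * real k / real (Suc i)" for i
    by (simp add: pmf_poisson_nonneg field_simps)
  have pair: "?p (k - Suc j) \<le> ?p (k + j)" if "j < k" for j
    using that
  proof (induction j)
    case 0
    then obtain i where "k = Suc i" by (cases k) auto
    then show ?case using rec[of "k - 1"] by simp
  next
    case (Suc j)
    define i where "i = k - Suc (Suc j)"
    have i: "k - Suc j = Suc i" "real i = real k - real j - 2" using Suc.prems by (auto simp: i_def)
    have "?p i = ?p (Suc i) * (real (Suc i) / real k)" using assms rec[of i] by (simp add: field_simps)
    also have "\<dots> \<le> ?p (k + j) * (real k / real (Suc (k + j)))"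
    proof (intro mult_mono)
      have "real (Suc i) * real (Suc (k + j)) = (real k)\<^sup>2 - (real j + 1)\<^sup>2"
        by (simp add: i(2) power2_eq_square) (simp add: algebra_simps)
      then have "real (Suc i) * real (Suc (k + j)) \<le> (real k)\<^sup>2" by simp
      then show "real (Suc i) / real k \<le> real k / real (Suc (k + j))"
        using assms by (simp add: power2_eq_square divide_simps mult_ac split: if_splits)
    qed (use Suc i in auto)
    also have "\<dots> = ?p (k + Suc j)" using rec[of "k + j"] by simp
    finally show ?case by (simp add: i_def)
  qed
  have "measure_pmf.prob (poisson (real k)) {..<k} = (\<Sum>j<k. ?p j)"
    by (rule measure_measure_pmf_finite) simp
  also have "\<dots> = (\<Sum>j<k. ?p (k - Suc j))" by (rule sum.nat_diff_reindex[symmetric])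
  also have "\<dots> \<le> (\<Sum>j<k. ?p (k + j))" using pair by (intro sum_mono) auto
  also have "\<dots> = sum ?p ((+) k ` {..<k})" by (subst sum.reindex) auto
  also have "\<dots> = measure_pmf.prob (poisson (real k)) ((+) k ` {..<k})"
    by (rule measure_measure_pmf_finite[symmetric]) simp
  also have "\<dots> \<le> measure_pmf.prob (poisson (real k)) {j. k \<le> j}"
    by (intro measure_pmf.finite_measure_mono) auto
  finally have "measure_pmf.prob (poisson (real k)) {..<k} \<le> measure_pmf.prob (poisson (real k)) {j. k \<le> j}" .
  moreover have "measure_pmf.prob (poisson (real k)) {j. k \<le> j} = 1 - measure_pmf.prob (poisson (real k)) {..<k}"
    using measure_pmf.prob_compl[of "{..<k}" "poisson (real k)"]
    by (simp add: Compl_eq_Diff_UNIV[symmetric] not_less lessThan_def Collect_neg_eq[symmetric])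
  ultimately show ?thesis by linarith
qed

lemma poisson_cdf_antimono_nat:
  assumes "0 \<le> a" "a \<le> b"
  shows "measure_pmf.prob (poisson b) {..m} \<le> measure_pmf.prob (poisson a) {..m}"
proof -
  \<comment> \<open>The derivative of the distribution function in the mean telescopes.\<close>
  have D: "((\<lambda>\<nu>. \<Sum>i\<le>m. \<nu> ^ i / fact i * exp (- \<nu>)) has_real_derivative
      - (\<nu> ^ m / fact m * exp (- \<nu>))) (at \<nu>)" for \<nu> :: real
  proof (induction m)
    case 0
    show ?case by (auto intro!: derivative_eq_intros)
  next
    case (Suc m)
    have "((\<lambda>\<nu>. \<nu> ^ Suc m / fact (Suc m) * exp (- \<nu>)) has_real_derivative
       (real (Suc m) * \<nu> ^ m / fact (Suc m) * exp (- \<nu>) - \<nu> ^ Suc m / fact (Suc m) * exp (- \<nu>))) (at \<nu>)"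
      by (rule derivative_eq_intros refl | simp)+
    moreover have "real (Suc m) * \<nu> ^ m / fact (Suc m) = \<nu> ^ m / fact m"
      by (simp add: divide_simps)
    ultimately have "((\<lambda>\<nu>. \<nu> ^ Suc m / fact (Suc m) * exp (- \<nu>)) has_real_derivative
       (\<nu> ^ m / fact m * exp (- \<nu>) - \<nu> ^ Suc m / fact (Suc m) * exp (- \<nu>))) (at \<nu>)" by simp
    from DERIV_add[OF Suc this] show ?case by simp
  qed
  have "(\<Sum>i\<le>m. b ^ i / fact i * exp (- b)) \<le> (\<Sum>i\<le>m. a ^ i / fact i * exp (- a))"
    by (rule DERIV_nonpos_imp_nonincreasing[OF assms(2)])
      (use D assms in \<open>fastforce intro!: mult_nonneg_nonneg divide_nonneg_nonneg\<close>)
  then show ?thesis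
    using assms by (simp add: measure_measure_pmf_finite pmf_poisson_nonneg)
qed

lemma poisson_lower_tail_antimono:
  assumes "0 \<le> a" "a \<le> b"
  shows "measure_pmf.prob (poisson b) {k. real k \<le> t} \<le> measure_pmf.prob (poisson a) {k. real k \<le> t}"
proof (cases "t < 0")
  case True
  then have "{k. real k \<le> t} = {}" by (auto simp: not_le)
  then show ?thesis by simp
next
  case False
  then have "{k. real k \<le> t} = {..nat \<lfloor>t\<rfloor>}" by (auto simp: le_nat_iff le_floor_iff)
  then show ?thesis using poisson_cdf_antimono_nat[OF assms] by simp
qed

lemma poisson_upper_tail_mono:
  assumes "0 \<le> a" "a \<le> b"
  shows "measure_pmf.prob (poisson a) {k. t \<le> real k} \<le> measure_pmf.prob (poisson b) {k. t \<le> real k}"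
proof (cases "t \<le> 0")
  case True
  then have "{k. t \<le> real k} = UNIV" by (auto intro: order_trans)
  then show ?thesis by simp
next
  case False
  have "{k. t \<le> real k} = - {..nat \<lceil>t\<rceil> - 1}"
  proof (intro set_eqI)
    fix k
    have "t \<le> real k \<longleftrightarrow> nat \<lceil>t\<rceil> \<le> k" by (simp add: nat_le_iff ceiling_le_iff)
    moreover have "nat \<lceil>t\<rceil> > 0" using False by simp
    ultimately show "k \<in> {k. t \<le> real k} \<longleftrightarrow> k \<in> - {..nat \<lceil>t\<rceil> - 1}"
      by (simp add: not_le) linarith
  qed
  moreover have "measure_pmf.prob (poisson x) (- {..m}) = 1 - measure_pmf.prob (poisson x) {..m}" for x m
    using measure_pmf.prob_compl[of "{..m}" "poisson x"] by (simp add: Compl_eq_Diff_UNIV)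
  ultimately show ?thesis using poisson_cdf_antimono_nat[OF assms] by simp
qed

section \<open>Tails at the test thresholds\<close>

text \<open>The quantity \<open>ln (1 / A)\<close> that governs all thresholds and tails.\<close>

definition log_lev :: "real \<Rightarrow> nat \<Rightarrow> real \<Rightarrow> real" where
  "log_lev \<alpha> n \<epsilon> = ln (1 / A_lev \<alpha> n \<epsilon>)"

text \<open>The regime of the theorem: \<open>A\<close> lies below a tiny constant. The exponent \<open>2000\<close> is a convenient
  choice and is not optimised.\<close>

definition small_lev :: "real \<Rightarrow> nat \<Rightarrow> real \<Rightarrow> bool" where
  "small_lev \<alpha> n \<epsilon> \<longleftrightarrow> 0 < A_lev \<alpha> n \<epsilon> \<and> A_lev \<alpha> n \<epsilon> \<le> exp (- 2000)"

lemma small_levD: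
  assumes "small_lev \<alpha> n \<epsilon>"
  shows "2000 \<le> log_lev \<alpha> n \<epsilon>" "sqrt (A_lev \<alpha> n \<epsilon>) = exp (- (log_lev \<alpha> n \<epsilon> / 2))"
    and "40 \<le> sqrt (log_lev \<alpha> n \<epsilon>)"
proof -
  have A: "0 < A_lev \<alpha> n \<epsilon>" "A_lev \<alpha> n \<epsilon> \<le> exp (- 2000)"
    using assms by (auto simp: small_lev_def)
  then have "ln (A_lev \<alpha> n \<epsilon>) \<le> - 2000" by (metis ln_exp ln_mono)
  then show *: "2000 \<le> log_lev \<alpha> n \<epsilon>" using A by (simp add: log_lev_def ln_div)
  have "exp (- (log_lev \<alpha> n \<epsilon> / 2)) ^ 2 = exp (- log_lev \<alpha> n \<epsilon>)"
    by (simp add: power2_eq_square flip: exp_add)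
  also have "\<dots> = A_lev \<alpha> n \<epsilon>" using A by (simp add: log_lev_def ln_div)
  finally show "sqrt (A_lev \<alpha> n \<epsilon>) = exp (- (log_lev \<alpha> n \<epsilon> / 2))"
    by (intro real_sqrt_unique) auto
  show "40 \<le> sqrt (log_lev \<alpha> n \<epsilon>)" using * by (intro real_le_rsqrt) auto
qed

text \<open>A tail of order \<open>A powr (1/8)\<close> dwarfs \<open>sqrt A\<close> in this regime.\<close>

lemma small_lev_margin:
  assumes "small_lev \<alpha> n \<epsilon>" "1 / 4 * exp (- (log_lev \<alpha> n \<epsilon> / 8)) \<le> p"
  shows "100 * sqrt (A_lev \<alpha> n \<epsilon>) \<le> p"
proof -
  let ?l = "log_lev \<alpha> n \<epsilon>"
  have "400 \<le> 1 + 3 * ?l / 8" using small_levD(1)[OF assms(1)] by simp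
  also have "\<dots> \<le> exp (3 * ?l / 8)" by (rule exp_ge_add_one_self)
  finally have "400 * exp (- (?l / 2)) \<le> exp (3 * ?l / 8) * exp (- (?l / 2))" by simp
  also have "\<dots> = exp (- (?l / 8))" by (simp flip: exp_add)
  finally show ?thesis using assms(2) small_levD(2)[OF assms(1)] by simp
qed

lemma t_shift_cases:
  assumes "small_lev \<alpha> n \<epsilon>" "\<mu> > 0"
  obtains "t_shift \<alpha> n \<mu> \<epsilon> = \<mu> / 2" "\<mu> \<le> log_lev \<alpha> n \<epsilon> / 16"
  | "t_shift \<alpha> n \<mu> \<epsilon> = sqrt \<mu> * sqrt (log_lev \<alpha> n \<epsilon>) / 8" "\<mu> > log_lev \<alpha> n \<epsilon> / 16"
proof -
  let ?a = "sqrt \<mu>" and ?b = "sqrt (log_lev \<alpha> n \<epsilon>)"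
  have "0 < log_lev \<alpha> n \<epsilon>" using small_levD(1)[OF assms(1)] by linarith
  then have a: "?a > 0" "?a * ?a = \<mu>" and b: "?b > 0" "?b * ?b = log_lev \<alpha> n \<epsilon>"
    using assms(2) by simp_all
  have s: "t_shift \<alpha> n \<mu> \<epsilon> = min (?a * ?a / 2) (?a * ?b / 8)"
    using a by (simp add: t_shift_def log_lev_def real_sqrt_mult)
  show thesis
  proof (cases "?a * 4 \<le> ?b")
    case True
    then have "(?a * 4) * (?a * 4) \<le> ?b * ?b" using a b(1) by (intro mult_mono) auto
    also have "(?a * 4) * (?a * 4) = 16 * (?a * ?a)" by simp
    finally have "\<mu> \<le> log_lev \<alpha> n \<epsilon> / 16" unfolding a(2) b(2) by simp
    moreover have "(?a * ?a) * 4 \<le> ?a * ?b"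
      using a(1) True mult_left_mono[of "?a * 4" ?b ?a] by (simp only: mult.assoc)
    then have "t_shift \<alpha> n \<mu> \<epsilon> = \<mu> / 2" unfolding s a(2) by (simp add: min_def)
    ultimately show thesis using that(1) by blast
  next
    case False
    then have "?b * ?b < (?a * 4) * (?a * 4)" using a(1) b assms(2) by (intro mult_strict_mono) auto
    also have "(?a * 4) * (?a * 4) = 16 * (?a * ?a)" by simp
    finally have "\<mu> > log_lev \<alpha> n \<epsilon> / 16" unfolding a(2) b(2) by simp
    moreover have "?a * ?b \<le> (?a * ?a) * 4"
      using a(1) assms(2) False mult_left_mono[of ?b "?a * 4" ?a] by (simp only: mult.assoc)
    then have "t_shift \<alpha> n \<mu> \<epsilon> = ?a * ?b / 8" unfolding s a(2) by (simp add: min_def)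
    ultimately show thesis using that(2) by blast
  qed
qed

lemma t_shift_pos:
  assumes "small_lev \<alpha> n \<epsilon>" "\<mu> > 0"
  shows "0 < t_shift \<alpha> n \<mu> \<epsilon>"
proof -
  have "0 < log_lev \<alpha> n \<epsilon>" using small_levD(1)[OF assms(1)] by linarith
  then show ?thesis using assms(2) by (simp add: t_shift_def flip: log_lev_def)
qed

text \<open>Both mean shifts \<open>r_over\<close> and \<open>r_under\<close> have the form \<open>\<mu> / (4 * t_shift)\<close>. The last claim is the
  reason for this choice: the tilt over the distance \<open>t_shift\<close> then has the fixed exponent \<open>1/4\<close>.\<close>

lemma t_shift_inverse_bounds:
  assumes "small_lev \<alpha> n \<epsilon>" "\<mu> > 0"
  defines "r \<equiv> \<mu> / (4 * t_shift \<alpha> n \<mu> \<epsilon>)"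
  shows "0 < r" "r \<le> 1 / 2 + 2 * (sqrt \<mu> / sqrt (log_lev \<alpha> n \<epsilon>))"
    and "\<mu> \<ge> 1 \<Longrightarrow> r \<le> \<mu> / 2" "r * t_shift \<alpha> n \<mu> \<epsilon> / \<mu> = 1 / 4"
proof -
  let ?a = "sqrt \<mu>" and ?b = "sqrt (log_lev \<alpha> n \<epsilon>)"
  have a: "?a > 0" "\<mu> = ?a * ?a" and b: "?b > 0" "40 \<le> ?b"
    using assms small_levD[OF assms(1)] by auto
  have s: "0 < t_shift \<alpha> n \<mu> \<epsilon>" by (rule t_shift_pos) fact+
  show "0 < r" using s assms by simp
  show "r * t_shift \<alpha> n \<mu> \<epsilon> / \<mu> = 1 / 4" using s assms by simp
  have r: "r = 1 / 2 \<or> r = 2 * (?a / ?b)"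
  proof (cases rule: t_shift_cases[OF assms(1,2)])
    case 1
    then show ?thesis using assms by (simp add: r_def)
  next
    case 2
    have "r = ?a * ?a / (4 * (?a * ?b / 8))" using a(2)[symmetric] unfolding r_def 2 by simp
    also have "\<dots> = 2 * (?a / ?b)" using a(1) b by (simp add: field_simps)
    finally show ?thesis ..
  qed
  then show "r \<le> 1 / 2 + 2 * (?a / ?b)"
  proof
    assume "r = 1 / 2"
    moreover have "0 \<le> ?a / ?b" using a(1) b(1) by (intro divide_nonneg_nonneg) auto
    ultimately show ?thesis by linarith
  qed linarith
  show "r \<le> \<mu> / 2" if "\<mu> \<ge> 1"
  proof -
    have "?a \<ge> 1" using that by simp
    have "?a / ?b \<le> ?a / 4" using a b by (intro divide_left_mono) auto
    moreover have "?a * 1 \<le> ?a * ?a" using \<open>?a \<ge> 1\<close> a by (intro mult_left_mono) auto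
    ultimately show ?thesis using r that a(2) by linarith
  qed
qed

lemma r_over_eq: "\<mu> > 0 \<Longrightarrow> r_over \<alpha> n \<mu> \<epsilon> = \<mu> / (4 * t_shift \<alpha> n \<mu> \<epsilon>)"
  by (simp add: r_over_def t_over_def)

lemma r_under_eq: "\<mu> \<ge> 1 \<Longrightarrow> r_under \<alpha> n \<mu> \<epsilon> = \<mu> / (4 * t_shift \<alpha> n \<mu> \<epsilon>)"
  by (simp add: r_under_def t_under_def)

lemma t_shift_le: "t_shift \<alpha> n \<mu> \<epsilon> \<le> \<mu> / 2"
  by (simp add: t_shift_def)

lemma t_shift_le_sqrt:
  "t_shift \<alpha> n \<mu> \<epsilon> \<le> sqrt \<mu> * sqrt (log_lev \<alpha> n \<epsilon>) / 8"
  by (simp add: t_shift_def log_lev_def real_sqrt_mult)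

text \<open>Chernoff's bound obtained by tilting the mean \<open>t - sqrt t\<close> down by \<open>sqrt t\<close>, with exponent at least \<open>1\<close>.\<close>

lemma poisson_prob_le_sqrt_half:
  assumes "t \<ge> 4"
  shows "1 / 2 \<le> measure_pmf.prob (poisson (t - 2 * sqrt t)) {k. real k \<le> t}"
proof -
  have s: "sqrt t * sqrt t = t" "sqrt t \<ge> 2" using assms by (auto intro: real_le_rsqrt)
  have "2 * sqrt t \<le> sqrt t * sqrt t" using s by (intro mult_right_mono) auto
  then have st: "2 * sqrt t \<le> t" using s by simp
  have "measure_pmf.prob (poisson (t - sqrt t - sqrt t)) {k. t \<le> real k}
     \<le> exp (- (sqrt t * (t - (t - sqrt t)) / (t - sqrt t)))
        * measure_pmf.prob (poisson (t - sqrt t)) {k. t \<le> real k}"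
    using s st by (intro poisson_upper_tail_tilt) auto
  also have "\<dots> \<le> exp (- 1) * 1"
    using s st by (intro mult_mono) (auto simp: field_simps)
  also have "\<dots> \<le> (1 / 2 :: real)"
  proof -
    have "2 \<le> exp (1 :: real)" using exp_ge_add_one_self[of 1] by simp
    then show ?thesis by (simp add: exp_minus field_simps)
  qed
  finally have "measure_pmf.prob (poisson (t - 2 * sqrt t)) {k. t \<le> real k} \<le> 1 / 2" by simp
  moreover have "measure_pmf.prob (poisson (t - 2 * sqrt t)) UNIV
      \<le> measure_pmf.prob (poisson (t - 2 * sqrt t)) ({k. real k \<le> t} \<union> {k. t \<le> real k})"
    by (intro measure_pmf.finite_measure_mono) auto
  moreover have "\<dots> \<le> measure_pmf.prob (poisson (t - 2 * sqrt t)) {k. real k \<le> t}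
     + measure_pmf.prob (poisson (t - 2 * sqrt t)) {k. t \<le> real k}"
    by (intro measure_Un_le) auto
  ultimately show ?thesis by simp
qed

text \<open>If the threshold is \<open>\<mu> / 2\<close>, then \<open>\<mu> \<le> log_lev / 16\<close> and the atom at \<open>0\<close> is heavy enough. Otherwise the
  mean is shifted below the threshold, at the price of the chi-square divergence.\<close>

lemma poisson_lower_tail_margin:
  assumes "small_lev \<alpha> n \<epsilon>" "\<mu> \<ge> 0"
  shows "100 * sqrt (A_lev \<alpha> n \<epsilon>)
     \<le> measure_pmf.prob (poisson (\<mu> + r_over \<alpha> n \<mu> \<epsilon>)) {k. real k \<le> t_over \<alpha> n \<mu> \<epsilon>}"
    (is "_ \<le> measure_pmf.prob (poisson (\<mu> + ?r)) {k. real k \<le> ?t}")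
proof (rule small_lev_margin[OF assms(1)])
  let ?l = "log_lev \<alpha> n \<epsilon>"
  have l: "2000 \<le> ?l" "40 \<le> sqrt ?l" using small_levD[OF assms(1)] by auto
  have le: "exp (- (\<mu> + ?r)) \<le> measure_pmf.prob (poisson (\<mu> + ?r)) {k. real k \<le> ?t}" if "?r > 0"
  proof -
    have "?t \<ge> 0" using t_shift_le[of \<alpha> n \<mu> \<epsilon>] assms by (simp add: t_over_def)
    have "exp (- (\<mu> + ?r)) = measure_pmf.prob (poisson (\<mu> + ?r)) {0}"
      using that assms by (simp add: measure_pmf_single pmf_poisson_nonneg)
    also have "\<dots> \<le> measure_pmf.prob (poisson (\<mu> + ?r)) {k. real k \<le> ?t}"
      using \<open>?t \<ge> 0\<close> by (intro measure_pmf.finite_measure_mono) auto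
    finally show ?thesis .
  qed
  have small: "1 / 4 * exp (- (?l / 8)) \<le> measure_pmf.prob (poisson (\<mu> + ?r)) {k. real k \<le> ?t}"
    if "\<mu> \<le> ?l / 16" "?r = 1 / 2"
  proof -
    have "1 / 4 * exp (- (?l / 8)) \<le> exp (- (?l / 8))" by simp
    also have "\<dots> \<le> exp (- (\<mu> + ?r))" using that l by simp
    also have "\<dots> \<le> measure_pmf.prob (poisson (\<mu> + ?r)) {k. real k \<le> ?t}"
      using that by (intro le) simp
    finally show ?thesis .
  qed
  consider "\<mu> = 0" | "\<mu> > 0" using assms by linarith
  then show "1 / 4 * exp (- (?l / 8)) \<le> measure_pmf.prob (poisson (\<mu> + ?r)) {k. real k \<le> ?t}"
  proof cases
    case 1
    then show ?thesis using l by (intro small) (auto simp: r_over_def)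
  next
    case \<mu>: 2
    note r = t_shift_inverse_bounds[OF assms(1) \<mu>, folded r_over_eq[OF \<mu>]]
    from t_shift_cases[OF assms(1) \<mu>] show ?thesis
    proof cases
      case 1
      then show ?thesis using \<mu> by (intro small) (auto simp: r_over_eq)
    next
      case 2
      \<comment> \<open>Under this mean the lower tail has probability at least one half.\<close>
      define \<nu>' where "\<nu>' = ?t - 2 * sqrt ?t"
      have t4: "?t \<ge> 4" using t_shift_le[of \<alpha> n \<mu> \<epsilon>] 2 l by (simp add: t_over_def)
      have t\<mu>: "?t \<le> \<mu>" using t_shift_pos[OF assms(1) \<mu>] by (simp add: t_over_def)
      have "2 \<le> sqrt ?t" using t4 by (intro real_le_rsqrt) auto
      then have "2 * sqrt ?t \<le> sqrt ?t * sqrt ?t" using t4 by (intro mult_right_mono) auto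
      then have \<nu>': "0 \<le> \<nu>'" using t4 by (simp add: \<nu>'_def)
      have "\<mu> + ?r - \<nu>' \<le> sqrt \<mu> * (sqrt ?l / 8 + 5)"
      proof -
        have "\<mu> + ?r - \<nu>' = t_shift \<alpha> n \<mu> \<epsilon> + ?r + 2 * sqrt ?t" by (simp add: \<nu>'_def t_over_def)
        moreover have "?r \<le> 1 / 2 + 2 * sqrt \<mu>"
        proof -
          have "sqrt \<mu> / sqrt ?l \<le> sqrt \<mu> / 1" using \<mu> l by (intro divide_left_mono) auto
          then show ?thesis using r(2) by simp
        qed
        moreover have "sqrt ?t \<le> sqrt \<mu>" using t\<mu> by simp
        moreover have "1 \<le> sqrt \<mu>" using 2 l by simp
        ultimately show ?thesis using t_shift_le_sqrt[of \<alpha> n \<mu> \<epsilon>] unfolding distrib_left by linarith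
      qed
      also have "\<dots> \<le> sqrt \<mu> * (sqrt ?l / 4)" using \<mu> l by (intro mult_left_mono) auto
      finally have d: "\<mu> + ?r - \<nu>' \<le> sqrt \<mu> * (sqrt ?l / 4)" .
      have "(\<mu> + ?r - \<nu>')\<^sup>2 \<le> (sqrt \<mu> * (sqrt ?l / 4))\<^sup>2"
      proof (rule power_mono[OF d])
        have "0 \<le> sqrt ?t" using t4 by simp
        then show "0 \<le> \<mu> + ?r - \<nu>'" using r(1) t\<mu> unfolding \<nu>'_def by linarith
      qed
      also have "\<dots> = \<mu> * (?l / 16)" using \<mu> l by (simp add: power_mult_distrib power_divide)
      also have "\<dots> \<le> (\<mu> + ?r) * (?l / 8)" using \<mu> l r(1) by (intro mult_mono) auto
      finally have "(\<mu> + ?r - \<nu>')\<^sup>2 / (\<mu> + ?r) \<le> ?l / 8"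
        using \<mu> r(1) by (simp add: pos_divide_le_eq mult.commute)
      then have "1 / 4 * exp (- (?l / 8)) \<le> 1 / 4 * exp (- ((\<mu> + ?r - \<nu>')\<^sup>2 / (\<mu> + ?r)))"
        by simp
      also have "\<dots> \<le> measure_pmf.prob (poisson (\<mu> + ?r)) {k. real k \<le> ?t}"
        using \<mu> r(1) \<nu>' poisson_prob_le_sqrt_half[OF t4]
        by (intro poisson_prob_shift_lower) (auto simp: \<nu>'_def)
      finally show ?thesis .
    qed
  qed
qed

lemma poisson_upper_tail_margin:
  assumes "small_lev \<alpha> n \<epsilon>" "\<mu> \<ge> 1"
  shows "100 * sqrt (A_lev \<alpha> n \<epsilon>)
     \<le> measure_pmf.prob (poisson (\<mu> - r_under \<alpha> n \<mu> \<epsilon>)) {k. t_under \<alpha> n \<mu> \<epsilon> \<le> real k}"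
    (is "_ \<le> measure_pmf.prob (poisson (\<mu> - ?r)) {k. ?t \<le> real k}")
proof (rule small_lev_margin[OF assms(1)])
  let ?l = "log_lev \<alpha> n \<epsilon>"
  have l: "2000 \<le> ?l" "40 \<le> sqrt ?l" using small_levD[OF assms(1)] by auto
  have \<mu>: "\<mu> > 0" using assms by simp
  note r = t_shift_inverse_bounds[OF assms(1) \<mu>, folded r_under_eq[OF assms(2)]]
  have r2: "?r \<le> \<mu> / 2" using r(3) assms by simp
  have t: "?t = \<mu> + t_shift \<alpha> n \<mu> \<epsilon>" using assms by (simp add: t_under_def)
  have s: "0 < t_shift \<alpha> n \<mu> \<epsilon>" by (rule t_shift_pos[OF assms(1) \<mu>])
  \<comment> \<open>Under the mean \<open>k\<close> the upper tail has probability at least one half.\<close>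
  define k where "k = nat \<lceil>?t\<rceil>"
  have k: "?t \<le> real k" "real k \<le> ?t + 1" "1 \<le> k"
    using assms s t unfolding k_def by linarith+
  have half: "1 / 2 \<le> measure_pmf.prob (poisson (real k)) {k. ?t \<le> real k}"
  proof -
    have "1 / 2 \<le> measure_pmf.prob (poisson (real k)) {j. k \<le> j}"
      by (rule poisson_ge_mean_ge_half[OF k(3)])
    also have "\<dots> \<le> measure_pmf.prob (poisson (real k)) {k. ?t \<le> real k}"
      using k by (intro measure_pmf.finite_measure_mono) auto
    finally show ?thesis .
  qed
  have "real k - (\<mu> - ?r) \<le> sqrt \<mu> * (sqrt ?l / 8 + 4)"
  proof -
    have "real k - (\<mu> - ?r) \<le> t_shift \<alpha> n \<mu> \<epsilon> + ?r + 1" using k(2) t by simp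
        moreover have "?r \<le> 1 / 2 + 2 * sqrt \<mu>"
        proof -
          have "sqrt \<mu> / sqrt ?l \<le> sqrt \<mu> / 1" using \<mu> l by (intro divide_left_mono) auto
          then show ?thesis using r(2) by simp
        qed
    moreover have "1 \<le> sqrt \<mu>" using assms by simp
    ultimately show ?thesis using t_shift_le_sqrt[of \<alpha> n \<mu> \<epsilon>] unfolding distrib_left by linarith
  qed
  also have "\<dots> \<le> sqrt \<mu> * (sqrt ?l / 4)" using \<mu> l by (intro mult_left_mono) auto
  finally have d: "real k - (\<mu> - ?r) \<le> sqrt \<mu> * (sqrt ?l / 4)" .
  have "(real k - (\<mu> - ?r))\<^sup>2 \<le> (sqrt \<mu> * (sqrt ?l / 4))\<^sup>2"
    using d \<mu> r(1) s k t by (intro power_mono) auto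
  also have "\<dots> = \<mu> / 2 * (?l / 8)" using \<mu> l by (simp add: power_mult_distrib power_divide)
  also have "\<dots> \<le> (\<mu> - ?r) * (?l / 8)" using r2 l by (intro mult_right_mono) auto
  finally have "(\<mu> - ?r - real k)\<^sup>2 / (\<mu> - ?r) \<le> ?l / 8"
    using \<mu> r2 by (simp add: pos_divide_le_eq mult.commute power2_commute)
  then have "1 / 4 * exp (- (?l / 8)) \<le> 1 / 4 * exp (- ((\<mu> - ?r - real k)\<^sup>2 / (\<mu> - ?r)))"
    by simp
  also have "\<dots> \<le> measure_pmf.prob (poisson (\<mu> - ?r)) {k. ?t \<le> real k}"
    using \<mu> r2 half by (intro poisson_prob_shift_lower) auto
  finally show "1 / 4 * exp (- (?l / 8)) \<le> measure_pmf.prob (poisson (\<mu> - ?r)) {k. ?t \<le> real k}" .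
qed

lemma exp_minus_quarter_le: "exp (- (1 / 4)) \<le> (4 / 5 :: real)"
proof -
  have "5 / 4 \<le> exp (1 / 4 :: real)" using exp_ge_add_one_self[of "1/4"] by simp
  then show ?thesis by (simp add: exp_minus field_simps)
qed

text \<open>The critical value stays a constant factor below the probability of the inspected ray under \<open>\<mu>\<close>:
  \<open>22/25 = 11/10 * 4/5\<close>. At \<open>\<mu> = 0\<close> the tilt is not available, but \<open>Poisson(0)\<close> and \<open>Poisson(1/2)\<close> are compared
  at the atom \<open>0\<close>.\<close>

lemma tau_over_le:
  assumes "small_lev \<alpha> n \<epsilon>" "\<mu> \<ge> 0"
  shows "tau_over \<alpha> n \<mu> \<epsilon> \<le> 22 / 25 * measure_pmf.prob (poisson \<mu>) {k. real k \<le> t_over \<alpha> n \<mu> \<epsilon>}"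
proof (cases "\<mu> = 0")
  case True
  have t: "t_over \<alpha> n 0 \<epsilon> = 0" by (simp add: t_over_def t_shift_def)
  have "{k. real k \<le> 0} = {0}" by auto
  then have "measure_pmf.prob (poisson (1 / 2)) {k. real k \<le> 0} = exp (- (1 / 2))"
    by (simp add: measure_pmf_single pmf_poisson_nonneg)
  also have "\<dots> \<le> exp (- (1 / 4))" by simp
  also note exp_minus_quarter_le
  finally show ?thesis using True t
    by (simp add: tau_over_def r_over_def poisson_def)
next
  case False
  then have \<mu>: "\<mu> > 0" using assms by simp
  note r = t_shift_inverse_bounds[OF assms(1) \<mu>, folded r_over_eq[OF \<mu>]]
  let ?P = "measure_pmf.prob (poisson \<mu>) {k. real k \<le> t_over \<alpha> n \<mu> \<epsilon>}"
  have "measure_pmf.prob (poisson (\<mu> + r_over \<alpha> n \<mu> \<epsilon>)) {k. real k \<le> t_over \<alpha> n \<mu> \<epsilon>}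
      \<le> exp (- (r_over \<alpha> n \<mu> \<epsilon> * (\<mu> - t_over \<alpha> n \<mu> \<epsilon>) / \<mu>)) * ?P"
    using \<mu> r(1) by (intro poisson_lower_tail_tilt) auto
  also have "r_over \<alpha> n \<mu> \<epsilon> * (\<mu> - t_over \<alpha> n \<mu> \<epsilon>) / \<mu> = 1 / 4"
    using r(4) by (simp add: t_over_def)
  also have "exp (- (1 / 4)) * ?P \<le> 4 / 5 * ?P"
    using exp_minus_quarter_le by (intro mult_right_mono) auto
  finally show ?thesis by (simp add: tau_over_def)
qed

lemma tau_under_le:
  assumes "small_lev \<alpha> n \<epsilon>" "\<mu> \<ge> 1"
  shows "tau_under \<alpha> n \<mu> \<epsilon> \<le> 22 / 25 * measure_pmf.prob (poisson \<mu>) {k. t_under \<alpha> n \<mu> \<epsilon> \<le> real k}"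
proof -
  have \<mu>: "\<mu> > 0" using assms by simp
  note r = t_shift_inverse_bounds[OF assms(1) \<mu>, folded r_under_eq[OF assms(2)]]
  let ?P = "measure_pmf.prob (poisson \<mu>) {k. t_under \<alpha> n \<mu> \<epsilon> \<le> real k}"
  have "measure_pmf.prob (poisson (\<mu> - r_under \<alpha> n \<mu> \<epsilon>)) {k. t_under \<alpha> n \<mu> \<epsilon> \<le> real k}
      \<le> exp (- (r_under \<alpha> n \<mu> \<epsilon> * (t_under \<alpha> n \<mu> \<epsilon> - \<mu>) / \<mu>)) * ?P"
    using \<mu> r(1) r(3)[OF assms(2)] by (intro poisson_upper_tail_tilt) auto
  also have "r_under \<alpha> n \<mu> \<epsilon> * (t_under \<alpha> n \<mu> \<epsilon> - \<mu>) / \<mu> = 1 / 4"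
    using r(4) assms by (simp add: t_under_def)
  also have "exp (- (1 / 4)) * ?P \<le> 4 / 5 * ?P"
    using exp_minus_quarter_le by (intro mult_right_mono) auto
  finally show ?thesis using assms by (simp add: tau_under_def)
qed

section \<open>Empirical frequencies along a chain of events\<close>

text \<open>The relative frequency of \<open>B\<close> among the observations \<open>X 1, \<dots>, X n\<close>.\<close>

definition emp_freq :: "nat \<Rightarrow> (nat \<Rightarrow> 'a) \<Rightarrow> 'a set \<Rightarrow> real" where
  "emp_freq n X B = 1 / real n * (\<Sum>i=1..n. of_bool (X i \<in> B))"

lemma emp_freq_mono: "A \<subseteq> B \<Longrightarrow> emp_freq n X A \<le> emp_freq n X B"
  unfolding emp_freq_def by (intro mult_left_mono sum_mono) auto

lemma emp_freq_measurable [measurable]: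
  assumes [measurable]: "B \<in> sets P"
  shows "(\<lambda>X. emp_freq n X B) \<in> borel_measurable (Pi\<^sub>M {1..n} (\<lambda>_. P))"
proof -
  have "(\<lambda>X. of_bool (X i \<in> B) :: real) \<in> borel_measurable (Pi\<^sub>M {1..n} (\<lambda>_. P))"
    if "i \<in> {1..n}" for i
  proof -
    have [measurable]: "(\<lambda>X. X i) \<in> measurable (Pi\<^sub>M {1..n} (\<lambda>_. P)) P"
      using that by measurable
    show ?thesis by measurable
  qed
  then show ?thesis unfolding emp_freq_def
    by (intro borel_measurable_times borel_measurable_const borel_measurable_sum)
qed

lemma (in prob_space) emp_freq_exponential_moment:
  assumes [measurable]: "B \<in> sets M"
  shows "(\<integral>X. exp (\<theta> * (\<Sum>i=1..n. of_bool (X i \<in> B))) \<partial>Pi\<^sub>M {1..n} (\<lambda>_. M))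
    \<le> exp (real n * prob B * (exp \<theta> - 1))"
proof -
  interpret product_sigma_finite "\<lambda>_ :: nat. M" ..
  let ?f = "\<lambda>x. exp (\<theta> * of_bool (x \<in> B)) :: real"
  have f: "?f x = 1 + (exp \<theta> - 1) * indicator B x" for x by (simp add: indicator_def)
  have "integrable M ?f" unfolding f by (simp add: less_top[symmetric])
  moreover have "(\<integral>x. ?f x \<partial>M) = 1 + (exp \<theta> - 1) * prob B"
    unfolding f by (simp add: prob_space less_top[symmetric])
  ultimately have "(\<integral>X. (\<Prod>i\<in>{1..n}. ?f (X i)) \<partial>Pi\<^sub>M {1..n} (\<lambda>_. M)) = (1 + (exp \<theta> - 1) * prob B) ^ n"
    by (subst product_integral_prod) auto
  also have "\<dots> \<le> exp ((exp \<theta> - 1) * prob B) ^ n"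
  proof (intro power_mono exp_ge_add_one_self)
    have "(1 - exp \<theta>) * prob B \<le> 1 * prob B" by (intro mult_right_mono) auto
    also have "\<dots> \<le> 1" by simp
    finally show "0 \<le> 1 + (exp \<theta> - 1) * prob B" by (simp add: algebra_simps)
  qed
  also have "\<dots> = exp (real n * prob B * (exp \<theta> - 1))"
    by (simp add: mult_ac flip: exp_of_nat_mult)
  finally show ?thesis by (simp only: sum_distrib_left exp_sum[OF finite_atLeastAtMost])
qed

text \<open>Upper deviations are covered by \<open>\<theta> > 0\<close>, lower deviations by \<open>\<theta> < 0\<close>.\<close>

lemma (in prob_space) emp_freq_chernoff:
  assumes [measurable]: "B \<in> sets M" and "n > 0"
  defines "S \<equiv> Pi\<^sub>M {1..n} (\<lambda>_. M)"
  shows "measure S {X \<in> space S. y \<le> \<theta> * (real n * emp_freq n X B)}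
     \<le> exp (real n * prob B * (exp \<theta> - 1) - y)"
proof -
  interpret S: prob_space S unfolding S_def by (rule prob_space_PiM) (rule prob_space_axioms)
  let ?N = "\<lambda>X. real n * emp_freq n X B"
  have N: "?N X = (\<Sum>i=1..n. of_bool (X i \<in> B))" for X using assms(2) by (simp add: emp_freq_def)
  have meas [measurable]: "?N \<in> borel_measurable S" unfolding S_def by measurable
  have "0 \<le> ?N X" "?N X \<le> real n" for X
  proof -
    show "0 \<le> ?N X" unfolding N by (intro sum_nonneg) auto
    have "?N X \<le> (\<Sum>i=1..n. 1)" unfolding N by (intro sum_mono) auto
    then show "?N X \<le> real n" by simp
  qed
  then have "\<theta> * ?N X \<le> \<bar>\<theta>\<bar> * real n" for X
    by (intro order_trans[OF mult_right_mono mult_left_mono]) auto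
  then have int: "integrable S (\<lambda>X. exp (\<theta> * ?N X))"
    by (intro S.integrable_const_bound[where B = "exp (\<bar>\<theta>\<bar> * real n)"]) auto
  have "{X \<in> space S. y \<le> \<theta> * ?N X} = {X \<in> space S. exp y \<le> exp (\<theta> * ?N X)}" by simp
  also have "measure S \<dots> \<le> (\<integral>X. exp (\<theta> * ?N X) \<partial>S) / exp y"
    by (rule integral_Markov_inequality_measure[OF int sets.empty_sets]) auto
  also have "(\<integral>X. exp (\<theta> * ?N X) \<partial>S) \<le> exp (real n * prob B * (exp \<theta> - 1))"
    unfolding N S_def by (rule emp_freq_exponential_moment) fact
  finally show ?thesis by (simp add: exp_diff divide_right_mono)
qed

lemma (in prob_space) emp_freq_upper_deviation:
  assumes B: "B \<in> sets M" "prob B \<le> q" and q: "q \<le> 1" and "n > 0" and D: "0 < D" "D \<le> 1"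
  defines "S \<equiv> Pi\<^sub>M {1..n} (\<lambda>_. M)"
  shows "measure S {X \<in> space S. q + D \<le> emp_freq n X B} \<le> exp (- (real n * D\<^sup>2 / 4))"
proof -
  let ?t = "D / 2"
  have "{X \<in> space S. q + D \<le> emp_freq n X B}
     = {X \<in> space S. ?t * (real n * (q + D)) \<le> ?t * (real n * emp_freq n X B)}"
    using D \<open>n > 0\<close> by simp
  also have "measure S \<dots> \<le> exp (real n * prob B * (exp ?t - 1) - ?t * (real n * (q + D)))"
    unfolding S_def by (rule emp_freq_chernoff) fact+
  also have "\<dots> \<le> exp (- (real n * D\<^sup>2 / 4))"
  proof -
    have e: "exp ?t - 1 \<le> ?t + ?t\<^sup>2" using exp_bound[of ?t] D by simp
    have "0 \<le> q" using B(2) measure_nonneg[of M B] by linarith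
    have "prob B * (exp ?t - 1) \<le> q * (?t + ?t\<^sup>2)"
      using B(2) e D by (intro mult_mono) (auto simp: \<open>0 \<le> q\<close>)
    also have "\<dots> = q * ?t + q * ?t\<^sup>2" by (simp add: algebra_simps)
    also have "\<dots> \<le> q * ?t + 1 * ?t\<^sup>2" using q by (intro add_left_mono mult_right_mono) auto
    finally have "prob B * (exp ?t - 1) - ?t * (q + D) \<le> - (D\<^sup>2 / 4)"
      by (simp add: power2_eq_square algebra_simps add_divide_distrib)
    from mult_left_mono[OF this, of "real n"] show ?thesis
      by (simp add: algebra_simps add_divide_distrib)
  qed
  finally show ?thesis .
qed

lemma (in prob_space) prob_Union_countable_chain_le:
  assumes C: "countable C" "C \<subseteq> events" and chain: "\<And>A B. A \<in> C \<Longrightarrow> B \<in> C \<Longrightarrow> A \<subseteq> B \<or> B \<subseteq> A"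
    and le: "\<And>A. A \<in> C \<Longrightarrow> prob A \<le> p" and "0 \<le> p"
  shows "prob (\<Union>C) \<le> p"
proof (cases "C = {}")
  case False
  define A where "A n = (\<Union>i\<le>n. from_nat_into C i)" for n
  have AC: "A n \<in> C" for n
  proof (induction n)
    case 0
    show ?case using False by (simp add: A_def from_nat_into)
  next
    case (Suc n)
    have "A (Suc n) = A n \<union> from_nat_into C (Suc n)" by (simp add: A_def atMost_Suc Un_commute)
    moreover have "from_nat_into C (Suc n) \<in> C" using False by (rule from_nat_into)
    ultimately show ?case using chain[OF Suc, of "from_nat_into C (Suc n)"] Suc
      by (auto simp: sup.absorb1 sup.absorb2)
  qed
  have "incseq A" unfolding A_def by (intro monoI UN_mono) auto
  then have "(\<lambda>n. prob (A n)) \<longlonglongrightarrow> prob (\<Union>n. A n)"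
    using AC C by (intro finite_Lim_measure_incseq) auto
  moreover have "(\<Union>n. A n) = \<Union>C"
  proof -
    have "(\<Union>n. A n) = (\<Union>n. from_nat_into C n)" by (auto simp: A_def)
    also have "\<dots> = \<Union>C" using C False by (simp add: range_from_nat_into)
    finally show ?thesis .
  qed
  ultimately show ?thesis using le[OF AC] by (intro LIMSEQ_le_const2) auto
qed (use assms in auto)

text \<open>In a chain, the members of probability at most \<open>j / m\<close> have a union of probability at most \<open>j / m\<close>, so
  the deviations of the \<open>m + 1\<close> unions control those of all members, up to \<open>1 / m\<close>.
  The exceptional set is provided as an explicit measurable set, since it is used as part of a larger
  one.\<close>

lemma (in prob_space) emp_freq_chain_upper_deviation:
  assumes C: "countable C" "C \<subseteq> events" and chain: "\<And>A B. A \<in> C \<Longrightarrow> B \<in> C \<Longrightarrow> A \<subseteq> B \<or> B \<subseteq> A"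
    and n: "n > 0" and m: "m > 0"
  defines "S \<equiv> Pi\<^sub>M {1..n} (\<lambda>_. M)"
  obtains N where "N \<in> sets S" "measure S N \<le> real (m + 1) * exp (- (real n / (4 * (real m)\<^sup>2)))"
    "\<And>X B. X \<in> space S - N \<Longrightarrow> B \<in> C \<Longrightarrow> emp_freq n X B \<le> prob B + 2 / real m"
proof
  interpret S: prob_space S unfolding S_def by (rule prob_space_PiM) (rule prob_space_axioms)
  define D where "D j = \<Union>{B \<in> C. prob B \<le> real j / real m}" for j
  define N where "N j = {X \<in> space S. real j / real m + 1 / real m \<le> emp_freq n X (D j)}" for j
  have D: "D j \<in> events" "prob (D j) \<le> real j / real m" for j
  proof -
    have c: "countable {B \<in> C. prob B \<le> real j / real m}" using C(1) by (rule countable_subset[rotated]) auto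
    show "D j \<in> events" unfolding D_def using C by (intro sets.countable_Union c) auto
    show "prob (D j) \<le> real j / real m"
      unfolding D_def using C chain by (intro prob_Union_countable_chain_le c) auto
  qed
  have N: "N j \<in> sets S" for j
    using emp_freq_measurable[OF D(1)] unfolding N_def S_def by measurable
  then show "(\<Union>j\<in>{..m}. N j) \<in> sets S" by auto
  have "measure S (\<Union>j\<in>{..m}. N j) \<le> (\<Sum>j\<in>{..m}. measure S (N j))"
    using N by (intro S.finite_measure_subadditive_finite) auto
  also have "\<dots> \<le> (\<Sum>j\<in>{..m}. exp (- (real n / (4 * (real m)\<^sup>2))))"
  proof (intro sum_mono)
    fix j assume "j \<in> {..m}"
    then have "measure S (N j) \<le> exp (- (real n * (1 / real m)\<^sup>2 / 4))"
      unfolding N_def S_def using m n by (intro emp_freq_upper_deviation D) auto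
    then show "measure S (N j) \<le> exp (- (real n / (4 * (real m)\<^sup>2)))"
      by (simp add: power_divide mult.commute)
  qed
  also have "\<dots> = real (m + 1) * exp (- (real n / (4 * (real m)\<^sup>2)))" by simp
  finally show "measure S (\<Union>j\<in>{..m}. N j) \<le> real (m + 1) * exp (- (real n / (4 * (real m)\<^sup>2)))" .
  fix X B assume X: "X \<in> space S - (\<Union>j\<in>{..m}. N j)" and B: "B \<in> C"
  define j where "j = nat \<lceil>real m * prob B\<rceil>"
  have "real m * prob B \<le> real m * 1" by (intro mult_left_mono) auto
  then have "j \<le> m" unfolding j_def by (simp add: ceiling_le_iff nat_le_iff)
  have j: "real m * prob B \<le> real j" "real j \<le> real m * prob B + 1"
    unfolding j_def using measure_nonneg[of M B] by (simp_all add: of_nat_ceiling)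
  have "emp_freq n X B \<le> emp_freq n X (D j)"
    using B j(1) m by (intro emp_freq_mono) (auto simp: D_def field_simps)
  also have "\<dots> \<le> real j / real m + 1 / real m" using X \<open>j \<le> m\<close> by (auto simp: N_def not_le intro: less_imp_le)
  also have "real j / real m \<le> prob B + 1 / real m" using j(2) m by (simp add: field_simps)
  finally show "emp_freq n X B \<le> prob B + 2 / real m" by simp
qed

lemma emp_freq_compl:
  assumes "n > 0" "X \<in> space (Pi\<^sub>M {1..n} (\<lambda>_. M))"
  shows "emp_freq n X (space M - B) = 1 - emp_freq n X B"
proof -
  have "(\<Sum>i=1..n. of_bool (X i \<in> space M - B)) = (\<Sum>i=1..n. 1 - of_bool (X i \<in> B) :: real)"
    using assms(2) by (intro sum.cong) (auto simp: space_PiM PiE_iff)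
  then show ?thesis using assms(1) by (simp add: emp_freq_def sum_subtractf field_simps)
qed

text \<open>The lower deviations are the upper deviations of the chain of complements.\<close>

lemma (in prob_space) emp_freq_chain_deviation:
  assumes C: "countable C" "C \<subseteq> events" and chain: "\<And>A B. A \<in> C \<Longrightarrow> B \<in> C \<Longrightarrow> A \<subseteq> B \<or> B \<subseteq> A"
    and n: "n > 0" and m: "m > 0"
  defines "S \<equiv> Pi\<^sub>M {1..n} (\<lambda>_. M)"
  obtains N where "N \<in> sets S" "measure S N \<le> 2 * (real (m + 1) * exp (- (real n / (4 * (real m)\<^sup>2))))"
    "\<And>X B. X \<in> space S - N \<Longrightarrow> B \<in> C \<Longrightarrow> \<bar>emp_freq n X B - prob B\<bar> \<le> 2 / real m"
proof -
  let ?C = "(\<lambda>B. space M - B) ` C" and ?b = "real (m + 1) * exp (- (real n / (4 * (real m)\<^sup>2)))"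
  obtain N1 where N1: "N1 \<in> sets S" "measure S N1 \<le> ?b"
    "\<And>X B. X \<in> space S - N1 \<Longrightarrow> B \<in> C \<Longrightarrow> emp_freq n X B \<le> prob B + 2 / real m"
    using emp_freq_chain_upper_deviation[OF C chain n m] unfolding S_def by metis
  obtain N2 where N2: "N2 \<in> sets S" "measure S N2 \<le> ?b"
    "\<And>X B. X \<in> space S - N2 \<Longrightarrow> B \<in> ?C \<Longrightarrow> emp_freq n X B \<le> prob B + 2 / real m"
  proof (rule emp_freq_chain_upper_deviation[of ?C n m])
    show "countable ?C" "?C \<subseteq> events" using C by auto
    show "A \<subseteq> B \<or> B \<subseteq> A" if "A \<in> ?C" "B \<in> ?C" for A B using that chain by blast
  qed (use n m in \<open>auto simp: S_def\<close>)
  show thesis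
  proof (rule that[of "N1 \<union> N2"])
    show "N1 \<union> N2 \<in> sets S" using N1 N2 by auto
    show "measure S (N1 \<union> N2) \<le> 2 * ?b"
      using measure_Un_le[OF N1(1) N2(1)] N1(2) N2(2) by simp
    fix X B assume X: "X \<in> space S - (N1 \<union> N2)" and B: "B \<in> C"
    have "emp_freq n X (space M - B) = 1 - emp_freq n X B"
      using X n by (intro emp_freq_compl) (auto simp: S_def)
    moreover have "prob (space M - B) = 1 - prob B" using B C by (intro prob_compl) auto
    moreover have "emp_freq n X (space M - B) \<le> prob (space M - B) + 2 / real m"
      using X B by (intro N2(3)) auto
    moreover have "emp_freq n X B \<le> prob B + 2 / real m" using X B by (intro N1(3)) auto
    ultimately show "\<bar>emp_freq n X B - prob B\<bar> \<le> 2 / real m" by linarith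
  qed
qed

section \<open>Contaminated laws, order statistics and measurability\<close>

lemma measure_contaminated_poisson:
  assumes \<epsilon>: "\<epsilon> \<in> {0..1}" and Q: "Q \<in> prob_distributions" and B: "B \<in> sets borel"
  shows "measure (contaminated_poisson \<epsilon> lam Q) B
    = (1 - \<epsilon>) * measure_pmf.prob (poisson lam) {k. real k \<in> B} + \<epsilon> * measure Q B"
proof -
  interpret Q: prob_space Q using Q by (simp add: prob_distributions_def)
  have "emeasure (distr (measure_pmf (poisson lam)) borel real) B
      = ennreal (measure_pmf.prob (poisson lam) {k. real k \<in> B})"
    using B by (simp add: emeasure_distr measure_pmf.emeasure_eq_measure vimage_def)
  then have "emeasure (contaminated_poisson \<epsilon> lam Q) B
      = ennreal (1 - \<epsilon>) * ennreal (measure_pmf.prob (poisson lam) {k. real k \<in> B})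
        + ennreal \<epsilon> * ennreal (measure Q B)"
    using Q B by (simp add: emeasure_contaminated_poisson prob_distributions_def Q.emeasure_eq_measure)
  also have "\<dots> = ennreal ((1 - \<epsilon>) * measure_pmf.prob (poisson lam) {k. real k \<in> B} + \<epsilon> * measure Q B)"
    using \<epsilon> by (simp add: ennreal_mult ennreal_plus)
  finally show ?thesis using \<epsilon> by (intro measure_eq_emeasure_eq_ennreal) auto
qed

lemma measure_contaminated_poisson_bounds:
  assumes \<epsilon>: "\<epsilon> \<in> {0..1}" and Q: "Q \<in> prob_distributions" and B: "B \<in> sets borel"
  shows "(1 - \<epsilon>) * measure_pmf.prob (poisson lam) {k. real k \<in> B}
      \<le> measure (contaminated_poisson \<epsilon> lam Q) B"
    and "measure (contaminated_poisson \<epsilon> lam Q) B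
      \<le> measure_pmf.prob (poisson lam) {k. real k \<in> B} + \<epsilon>"
proof -
  interpret Q: prob_space Q using Q by (simp add: prob_distributions_def)
  have "0 \<le> \<epsilon> * measure Q B" "\<epsilon> * measure Q B \<le> \<epsilon> * 1"
    using \<epsilon> Q.prob_le_1 by (auto intro!: mult_left_mono simp del: mult_1_right)
  moreover have "(1 - \<epsilon>) * measure_pmf.prob (poisson lam) {k. real k \<in> B}
      \<le> 1 * measure_pmf.prob (poisson lam) {k. real k \<in> B}"
    using \<epsilon> by (intro mult_right_mono) auto
  ultimately show "(1 - \<epsilon>) * measure_pmf.prob (poisson lam) {k. real k \<in> B}
      \<le> measure (contaminated_poisson \<epsilon> lam Q) B"
    "measure (contaminated_poisson \<epsilon> lam Q) B
      \<le> measure_pmf.prob (poisson lam) {k. real k \<in> B} + \<epsilon>"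
    by (simp_all add: measure_contaminated_poisson[OF assms])
qed

lemma nth_sorted_le_iff:
  fixes xs :: "'a :: linorder list"
  assumes "sorted xs" "j < length xs"
  shows "xs ! j \<le> c \<longleftrightarrow> j < length (filter (\<lambda>x. x \<le> c) xs)"
proof -
  have f: "length (filter (\<lambda>x. x \<le> c) xs) = card {i. i < length xs \<and> xs ! i \<le> c}"
    by (simp add: length_filter_conv_card)
  show ?thesis
  proof
    assume "xs ! j \<le> c"
    then have "{..j} \<subseteq> {i. i < length xs \<and> xs ! i \<le> c}"
      using assms sorted_nth_mono[OF assms(1)] by (auto intro: order_trans)
    then have "card {..j} \<le> card {i. i < length xs \<and> xs ! i \<le> c}" by (intro card_mono) auto
    then show "j < length (filter (\<lambda>x. x \<le> c) xs)" using f by simp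
  next
    assume l: "j < length (filter (\<lambda>x. x \<le> c) xs)"
    show "xs ! j \<le> c"
    proof (rule ccontr)
      assume n: "\<not> xs ! j \<le> c"
      have "i < j" if "i < length xs" "xs ! i \<le> c" for i
      proof (rule ccontr)
        assume "\<not> i < j"
        then have "xs ! j \<le> xs ! i" using that by (intro sorted_nth_mono[OF assms(1)]) auto
        with that n show False by auto
      qed
      then have "{i. i < length xs \<and> xs ! i \<le> c} \<subseteq> {..<j}" by auto
      then have "card {i. i < length xs \<and> xs ! i \<le> c} \<le> card {..<j}" by (intro card_mono) auto
      then show False using f l by simp
    qed
  qed
qed

text \<open>Order statistics enter only through empirical frequencies.\<close>

lemma order_statistic_le_iff:
  assumes "1 \<le> k" "k \<le> n"
  shows "order_statistic n X k \<le> c \<longleftrightarrow> real k \<le> real n * emp_freq n X {..c}"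
proof -
  let ?xs = "map X [1..<Suc n]"
  have "order_statistic n X k \<le> c \<longleftrightarrow> k - 1 < length (filter (\<lambda>x. x \<le> c) (sort ?xs))"
    unfolding order_statistic_def using assms by (intro nth_sorted_le_iff) (auto simp del: upt_Suc)
  also have "length (filter (\<lambda>x. x \<le> c) (sort ?xs)) = length (filter (\<lambda>x. x \<le> c) ?xs)"
    by (metis mset_filter mset_sort size_mset)
  also have "\<dots> = length (filter (\<lambda>i. X i \<le> c) [1..<Suc n])"
    by (simp add: filter_map o_def del: upt_Suc)
  also have "\<dots> = card (set (filter (\<lambda>i. X i \<le> c) [1..<Suc n]))"
    by (rule distinct_card[symmetric]) (simp del: upt_Suc)
  also have "set (filter (\<lambda>i. X i \<le> c) [1..<Suc n]) = {i \<in> {1..n}. X i \<le> c}" by auto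
  also have "k - 1 < card {i \<in> {1..n}. X i \<le> c} \<longleftrightarrow> real k \<le> real (card {i \<in> {1..n}. X i \<le> c})"
    using assms by auto
  also have "real (card {i \<in> {1..n}. X i \<le> c}) = real n * emp_freq n X {..c}"
    using assms by (simp add: emp_freq_def Int_def Collect_conj_eq[symmetric])
  finally show ?thesis .
qed

lemma lam_max_rank: "1 \<le> n \<Longrightarrow> 1 \<le> nat \<lceil>3 * real n / 4\<rceil> \<and> nat \<lceil>3 * real n / 4\<rceil> \<le> n"
  by (auto simp: nat_le_iff ceiling_le_iff Suc_le_eq)

lemma lam_max_le_iff:
  assumes "1 \<le> n"
  shows "lam_max n X \<le> c \<longleftrightarrow> real (nat \<lceil>3 * real n / 4\<rceil>) \<le> real n * emp_freq n X {..c - 1}"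
proof -
  have "lam_max n X \<le> c \<longleftrightarrow> order_statistic n X (nat \<lceil>3 * real n / 4\<rceil>) \<le> c - 1"
    by (auto simp: lam_max_def)
  then show ?thesis using order_statistic_le_iff lam_max_rank[OF assms] by blast
qed

lemma le_lam_maxI:
  assumes "1 \<le> n" "emp_freq n X {..<lam - 1} < 3 / 4"
  shows "lam \<le> lam_max n X"
proof (rule ccontr)
  assume "\<not> lam \<le> lam_max n X"
  then have less: "lam_max n X < lam" by simp
  have "real (nat \<lceil>3 * real n / 4\<rceil>) \<le> real n * emp_freq n X {..lam_max n X - 1}"
    using lam_max_le_iff[OF assms(1)] by blast
  also have "\<dots> \<le> real n * emp_freq n X {..<lam - 1}"
    using less by (intro mult_left_mono emp_freq_mono) auto
  also have "\<dots> < real n * (3 / 4)" using assms by (intro mult_strict_left_mono) auto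
  finally show False by linarith
qed

lemma emp_freq_ge: "n > 0 \<Longrightarrow> emp_freq n X {t..} = 1 - emp_freq n X {..<t}" for X :: "nat \<Rightarrow> real"
proof -
  assume "n > 0"
  have "(\<Sum>i=1..n. of_bool (X i \<in> {t..})) = (\<Sum>i=1..n. 1 - of_bool (X i \<in> {..<t}) :: real)"
    by (intro sum.cong) (auto simp: not_le)
  then show ?thesis using \<open>n > 0\<close> by (simp add: emp_freq_def sum_subtractf field_simps)
qed

lemma phi_plus_eq_0_iff:
  "phi_plus \<alpha> n X lam \<epsilon> = 0 \<longleftrightarrow> tau_over \<alpha> n lam \<epsilon> \<le> emp_freq n X {..t_over \<alpha> n lam \<epsilon>}"
  by (simp add: phi_plus_def emp_freq_def not_less)

lemma phi_minus_eq_0_iff: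
  "phi_minus \<alpha> n X lam \<epsilon> = 0 \<longleftrightarrow> tau_under \<alpha> n lam \<epsilon> \<le> emp_freq n X {t_under \<alpha> n lam \<epsilon>..}"
  by (simp add: phi_minus_def emp_freq_def not_less)

lemma psi_plus_eq_0_iff:
  "psi_plus \<alpha> n X lam \<epsilon> = 0 \<longleftrightarrow>
    lam_max n X \<le> lam \<or> (\<exists>\<mu>. int \<mu> \<le> \<lceil>lam\<rceil> \<and> phi_plus \<alpha> n X (real \<mu>) \<epsilon> = 0)"
  by (auto simp: psi_plus_def binary_min_eq_0_iff finite_nat_le_int)

lemma psi_minus_eq_0_iff:
  "psi_minus \<alpha> n X lam \<epsilon> = 0 \<longleftrightarrow>
    (lam < 1 \<and> phi_minus \<alpha> n X lam \<epsilon> = 0) \<or>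
    (\<exists>\<mu>\<ge>1. (lam < 1 \<or> \<lfloor>lam\<rfloor> \<le> int \<mu>) \<and> real \<mu> \<le> lam_max n X \<and> phi_minus \<alpha> n X (real \<mu>) \<epsilon> = 0)"
proof -
  have "min (a :: nat) b = 0 \<longleftrightarrow> a = 0 \<or> b = 0" for a b by (auto simp: min_def)
  moreover have "finite {\<mu>. 1 \<le> \<mu> \<and> \<lfloor>lam\<rfloor> \<le> int \<mu> \<and> real \<mu> \<le> lam_max n X}"
    using finite_nat_le_real[of "\<lambda>\<mu>. 1 \<le> \<mu> \<and> \<lfloor>lam\<rfloor> \<le> int \<mu>"] by (simp add: conj_assoc)
  ultimately show ?thesis
    by (auto simp: psi_minus_def binary_min_eq_0_iff finite_nat_le_real)
qed

lemma countable_eps_grid: "countable (eps_grid \<alpha> n \<epsilon>max)"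
proof -
  have "eps_grid \<alpha> n \<epsilon>max \<subseteq> range (\<lambda>k. 2 ^ k * ln (24 / \<alpha>) / real n) \<union> {\<epsilon>max}"
    by (auto simp: eps_grid_def)
  then show ?thesis by (rule countable_subset) auto
qed

text \<open>The library measure of a set that is not measurable is \<open>0\<close>, so the measurability of the two events is
  a genuine part of the claim.\<close>

lemma measurable_CI_hat:
  assumes P: "sets P = sets borel" and n: "1 \<le> n"
  defines "S \<equiv> Pi\<^sub>M {1..n} (\<lambda>_. P)"
  shows "{X \<in> space S. x \<in> CI_hat \<alpha> n \<epsilon>max X} \<in> sets S"
proof -
  have [measurable]: "(\<lambda>X. emp_freq n X B) \<in> borel_measurable S" if "B \<in> sets borel" for B
    unfolding S_def using that P by (intro emp_freq_measurable) auto
  have [measurable]: "lam_max n \<in> borel_measurable S"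
    unfolding borel_measurable_iff_le lam_max_le_iff[OF n] by measurable
  have [measurable]: "Measurable.pred S (\<lambda>X. phi_plus \<alpha> n X lam \<epsilon> = 0)"
    "Measurable.pred S (\<lambda>X. phi_minus \<alpha> n X lam \<epsilon> = 0)" for lam \<epsilon>
    unfolding phi_plus_eq_0_iff phi_minus_eq_0_iff by measurable
  have [measurable]: "Measurable.pred S (\<lambda>X. psi_plus \<alpha> n X lam \<epsilon> = 0)"
    "Measurable.pred S (\<lambda>X. psi_minus \<alpha> n X lam \<epsilon> = 0)" for lam \<epsilon>
    unfolding psi_plus_eq_0_iff psi_minus_eq_0_iff by measurable
  have [measurable]: "Measurable.pred S (\<lambda>X. \<forall>\<epsilon>\<in>eps_grid \<alpha> n \<epsilon>max.
      psi_plus \<alpha> n X x \<epsilon> = 0 \<and> psi_minus \<alpha> n X x \<epsilon> = 0)"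
    by (rule measurable_pred_countable(1)[OF countable_eps_grid]) measurable
  show ?thesis unfolding CI_hat_def mem_Collect_eq atLeastAtMost_iff by measurable
qed

text \<open>Rational end points suffice, which makes the length event a countable intersection.\<close>

lemma interval_length_le_iff:
  assumes S: "is_interval S" "bdd_above S" "bdd_below S" and c: "0 \<le> c"
  shows "interval_length S \<le> c \<longleftrightarrow> (\<forall>x\<in>\<rat>. \<forall>y\<in>\<rat>. x \<in> S \<longrightarrow> y \<in> S \<longrightarrow> y - x \<le> c)"
proof (cases "S = {}")
  case False
  have le: "y - x \<le> interval_length S" if "x \<in> S" "y \<in> S" for x y
    using cSup_upper[OF that(2) S(2)] cInf_lower[OF that(1) S(3)] False
    by (simp add: interval_length_def)
  show ?thesis
  proof (intro iffI ballI impI)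
    fix x y assume "interval_length S \<le> c" "x \<in> S" "y \<in> S"
    then show "y - x \<le> c" using le[of x y] by linarith
  next
    assume rat: "\<forall>x\<in>\<rat>. \<forall>y\<in>\<rat>. x \<in> S \<longrightarrow> y \<in> S \<longrightarrow> y - x \<le> c"
    have diff: "y - x \<le> c" if xy: "x \<in> S" "y \<in> S" for x y
    proof (rule ccontr)
      assume "\<not> y - x \<le> c"
      then have c': "c < y - x" by simp
      define d where "d = (y - x - c) / 2"
      have d: "d > 0" using c' by (simp add: d_def)
      obtain p where p: "p \<in> \<rat>" "x < p" "p < x + d" using Rats_dense_in_real[of x "x + d"] d by auto
      obtain q where q: "q \<in> \<rat>" "y - d < q" "q < y" using Rats_dense_in_real[of "y - d" y] d by auto
      have dd: "2 * d = y - x - c" by (simp add: d_def)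
      have between: "z \<in> S" if "x \<le> z" "z \<le> y" for z
        using S(1) xy that unfolding is_interval_1 by blast
      have "p \<in> S" "q \<in> S" using p q dd d c by (auto intro!: between)
      then have "q - p \<le> c" using rat p q by blast
      then show False using p q dd by linarith
    qed
    have "Sup S \<le> c + x" if "x \<in> S" for x
      using diff[OF that] False by (intro cSup_least) (auto simp: algebra_simps)
    then have "Sup S - c \<le> Inf S" using False by (intro cInf_greatest) (auto simp: algebra_simps)
    then show "interval_length S \<le> c" using False by (simp add: interval_length_def)
  qed
qed (use c in \<open>simp add: interval_length_def\<close>)

lemma CI_hat_interval_length_le_iff:
  assumes "0 \<le> c"
  shows "interval_length (CI_hat \<alpha> n \<epsilon>max X) \<le> c \<longleftrightarrow>
    (\<forall>x\<in>\<rat>. \<forall>y\<in>\<rat>. x \<in> CI_hat \<alpha> n \<epsilon>max X \<longrightarrow> y \<in> CI_hat \<alpha> n \<epsilon>max X \<longrightarrow> y - x \<le> c)"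
proof (intro interval_length_le_iff is_interval_CI_hat assms)
  have "CI_hat \<alpha> n \<epsilon>max X \<subseteq> {0..lam_max n X}" by (auto simp: CI_hat_def)
  then show "bdd_above (CI_hat \<alpha> n \<epsilon>max X)" "bdd_below (CI_hat \<alpha> n \<epsilon>max X)"
    by (rule bdd_above_mono[OF bdd_above_Icc], rule bdd_below_mono[OF bdd_below_Icc])
qed

lemma measurable_CI_hat_length:
  assumes P: "sets P = sets borel" and n: "1 \<le> n" and c: "0 \<le> c"
  defines "S \<equiv> Pi\<^sub>M {1..n} (\<lambda>_. P)"
  shows "{X \<in> space S. interval_length (CI_hat \<alpha> n \<epsilon>max X) \<le> c} \<in> sets S"
proof -
  have [measurable]: "Measurable.pred S (\<lambda>X. x \<in> CI_hat \<alpha> n \<epsilon>max X)" for x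
    using measurable_CI_hat[OF P n] unfolding S_def by (simp add: pred_def)
  show ?thesis
    unfolding CI_hat_interval_length_le_iff[OF c]
    by (intro predE measurable_pred_countable(1) countable_rat) measurable
qed

section \<open>Tests and interval on a good sample\<close>

lemma r_over_bounds:
  assumes "small_lev \<alpha> n e" "\<mu> \<ge> 0"
  shows "0 < r_over \<alpha> n \<mu> e" "r_over \<alpha> n \<mu> e \<le> 1 / 2 + 2 * (sqrt \<mu> / sqrt (log_lev \<alpha> n e))"
  using t_shift_inverse_bounds(1,2)[OF assms(1), of \<mu>] assms(2)
  by (cases "\<mu> = 0"; simp add: r_over_eq; simp add: r_over_def)+

lemma r_under_bounds:
  assumes "small_lev \<alpha> n e" "\<mu> \<ge> 1"
  shows "0 < r_under \<alpha> n \<mu> e" "r_under \<alpha> n \<mu> e \<le> 1 / 2 + 2 * (sqrt \<mu> / sqrt (log_lev \<alpha> n e))"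
    and "r_under \<alpha> n \<mu> e \<le> \<mu> / 2"
  using t_shift_inverse_bounds(1-3)[OF assms(1), of \<mu>] assms(2) by (simp_all add: r_under_eq)

text \<open>The level \<open>e\<close> tolerates a uniform deviation \<open>\<eta>\<close> of the empirical frequencies: \<open>\<eta>\<close> is small against
  the tail bound \<open>100 * sqrt A\<close>.\<close>

definition admissible :: "real \<Rightarrow> nat \<Rightarrow> real \<Rightarrow> real \<Rightarrow> bool" where
  "admissible \<alpha> n \<eta> e \<longleftrightarrow> small_lev \<alpha> n e \<and> \<eta> \<le> 5 * sqrt (A_lev \<alpha> n e)"

lemma A_lev_less_sqrt:
  assumes "small_lev \<alpha> n e"
  shows "A_lev \<alpha> n e \<le> sqrt (A_lev \<alpha> n e)" "0 < sqrt (A_lev \<alpha> n e)"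
proof -
  have A: "0 < A_lev \<alpha> n e" "A_lev \<alpha> n e \<le> exp (- 2000)" using assms by (auto simp: small_lev_def)
  have "exp (- 2000) \<le> (1 :: real)" by simp
  with A(2) have "A_lev \<alpha> n e \<le> 1" by linarith
  then have "(A_lev \<alpha> n e)\<^sup>2 \<le> A_lev \<alpha> n e" using A(1) by (simp add: power2_eq_square mult_left_le)
  then show "A_lev \<alpha> n e \<le> sqrt (A_lev \<alpha> n e)" using A(1) by (intro real_le_rsqrt) auto
  show "0 < sqrt (A_lev \<alpha> n e)" using A(1) by simp
qed

text \<open>A sample with fixed parameters. The bound on the contamination \<open>\<epsilon>\<close> leaves room between the factors
  \<open>22/25\<close> and \<open>1 - \<epsilon>\<close>.\<close>

locale contaminated_sample =
  fixes \<alpha> :: real and n :: nat and \<epsilon> lam :: real and Q :: "real measure"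
  assumes \<alpha>: "0 < \<alpha>" "\<alpha> < 1" and n: "1 \<le> n" and \<epsilon>: "0 \<le> \<epsilon>" "\<epsilon> \<le> 1 / 100"
    and lam: "0 \<le> lam" and Q: "Q \<in> prob_distributions"
begin

abbreviation "P \<equiv> contaminated_poisson \<epsilon> lam Q"
abbreviation "S \<equiv> sample_law n \<epsilon> lam Q"
abbreviation "L \<equiv> ln (24 / \<alpha>)"

text \<open>The sample \<open>X\<close> reproduces the true probabilities of both closed rays with end point \<open>t\<close> up to \<open>\<eta>\<close>.\<close>

definition accurate_at :: "real \<Rightarrow> (nat \<Rightarrow> real) \<Rightarrow> real \<Rightarrow> bool" where
  "accurate_at \<eta> X t \<longleftrightarrow> \<bar>emp_freq n X {..t} - measure P {..t}\<bar> \<le> \<eta>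
     \<and> \<bar>emp_freq n X {t..} - measure P {t..}\<bar> \<le> \<eta>"

text \<open>The end points of all rays that matter: the thresholds of the tests at the natural numbers and at
  the levels in \<open>E\<close>, and the point \<open>lam - 1\<close> that decides whether \<open>lam \<le> lam_max\<close>.\<close>

definition test_points :: "real set \<Rightarrow> real set" where
  "test_points E = insert (lam - 1)
     ((\<lambda>(\<mu> :: nat, e). t_over \<alpha> n (real \<mu>) e) ` (UNIV \<times> E) \<union> (\<lambda>(\<mu> :: nat, e). t_under \<alpha> n (real \<mu>) e) ` (UNIV \<times> E))"

lemma test_points [intro]:
  "lam - 1 \<in> test_points E"
  "e \<in> E \<Longrightarrow> t_over \<alpha> n (real \<mu>) e \<in> test_points E"
  "e \<in> E \<Longrightarrow> t_under \<alpha> n (real \<mu>) e \<in> test_points E"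
  by (auto simp: test_points_def)

lemma P_bounds:
  assumes "B \<in> sets borel"
  shows "99 / 100 * measure_pmf.prob (poisson lam) {k. real k \<in> B} \<le> measure P B"
    and "measure P B \<le> measure_pmf.prob (poisson lam) {k. real k \<in> B} + \<epsilon>"
proof -
  have "99 / 100 * measure_pmf.prob (poisson lam) {k. real k \<in> B}
      \<le> (1 - \<epsilon>) * measure_pmf.prob (poisson lam) {k. real k \<in> B}"
    using \<epsilon> by (intro mult_right_mono) auto
  also have "\<dots> \<le> measure P B"
    using \<epsilon> Q assms by (intro measure_contaminated_poisson_bounds) auto
  finally show "99 / 100 * measure_pmf.prob (poisson lam) {k. real k \<in> B} \<le> measure P B" .
  show "measure P B \<le> measure_pmf.prob (poisson lam) {k. real k \<in> B} + \<epsilon>"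
    using \<epsilon> Q assms by (intro measure_contaminated_poisson_bounds) auto
qed

lemma L_ge_3: "3 \<le> L"
proof -
  have "exp 3 = exp (1 :: real) ^ 3" by (simp flip: exp_of_nat_mult)
  also have "\<dots> \<le> (272 / 100 :: real) ^ 3" using e_less_272 by (intro power_mono) auto
  also have "\<dots> \<le> 24" by (simp add: power3_eq_cube)
  also have "\<dots> \<le> 24 / \<alpha>" using \<alpha> by (simp add: field_simps)
  finally show ?thesis using \<alpha> by (subst ln_ge_iff) auto
qed

lemma le_A_lev: "e \<le> A_lev \<alpha> n e"
  using L_ge_3 by (simp add: A_lev_def)

lemma phi_plus_accepts:
  assumes e: "admissible \<alpha> n \<eta> e" and \<mu>: "lam \<le> \<mu>" and acc: "accurate_at \<eta> X (t_over \<alpha> n \<mu> e)"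
  shows "phi_plus \<alpha> n X \<mu> e = 0"
proof -
  let ?t = "t_over \<alpha> n \<mu> e"
  let ?p = "\<lambda>\<nu>. measure_pmf.prob (poisson \<nu>) {k. real k \<le> ?t}"
  have s: "small_lev \<alpha> n e" "\<eta> \<le> 5 * sqrt (A_lev \<alpha> n e)" using e by (auto simp: admissible_def)
  have \<mu>0: "0 \<le> \<mu>" using lam \<mu> by simp
  have "100 * sqrt (A_lev \<alpha> n e) \<le> ?p (\<mu> + r_over \<alpha> n \<mu> e)"
    by (rule poisson_lower_tail_margin[OF s(1) \<mu>0])
  also have "\<dots> \<le> ?p \<mu>" using r_over_bounds(1)[OF s(1) \<mu>0] \<mu>0 by (intro poisson_lower_tail_antimono) auto
  finally have "20 * \<eta> \<le> ?p \<mu>" using s(2) by simp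
  moreover have "tau_over \<alpha> n \<mu> e \<le> 22 / 25 * ?p \<mu>" by (rule tau_over_le[OF s(1) \<mu>0])
  moreover have "99 / 100 * ?p \<mu> \<le> 99 / 100 * ?p lam"
    using \<mu> lam by (intro mult_left_mono poisson_lower_tail_antimono) auto
  moreover have "99 / 100 * ?p lam \<le> measure P {..?t}" using P_bounds(1)[of "{..?t}"] by simp
  moreover have "measure P {..?t} \<le> emp_freq n X {..?t} + \<eta>" using acc by (auto simp: accurate_at_def)
  moreover have "0 \<le> ?p \<mu>" by simp
  ultimately have "tau_over \<alpha> n \<mu> e \<le> emp_freq n X {..?t}" by linarith
  then show ?thesis by (simp add: phi_plus_eq_0_iff)
qed

lemma phi_minus_accepts:
  assumes e: "admissible \<alpha> n \<eta> e" and \<mu>: "1 \<le> \<mu>" "\<mu> \<le> lam" and acc: "accurate_at \<eta> X (t_under \<alpha> n \<mu> e)"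
  shows "phi_minus \<alpha> n X \<mu> e = 0"
proof -
  let ?t = "t_under \<alpha> n \<mu> e"
  let ?p = "\<lambda>\<nu>. measure_pmf.prob (poisson \<nu>) {k. ?t \<le> real k}"
  have s: "small_lev \<alpha> n e" "\<eta> \<le> 5 * sqrt (A_lev \<alpha> n e)" using e by (auto simp: admissible_def)
  note r = r_under_bounds[OF s(1) \<mu>(1)]
  have "100 * sqrt (A_lev \<alpha> n e) \<le> ?p (\<mu> - r_under \<alpha> n \<mu> e)"
    by (rule poisson_upper_tail_margin[OF s(1) \<mu>(1)])
  also have "\<dots> \<le> ?p \<mu>" using r(1,3) \<mu> by (intro poisson_upper_tail_mono) auto
  finally have "20 * \<eta> \<le> ?p \<mu>" using s(2) by simp
  moreover have "tau_under \<alpha> n \<mu> e \<le> 22 / 25 * ?p \<mu>" by (rule tau_under_le[OF s(1) \<mu>(1)])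
  moreover have "99 / 100 * ?p \<mu> \<le> 99 / 100 * ?p lam"
    using \<mu> by (intro mult_left_mono poisson_upper_tail_mono) auto
  moreover have "99 / 100 * ?p lam \<le> measure P {?t..}" using P_bounds(1)[of "{?t..}"] by simp
  moreover have "measure P {?t..} \<le> emp_freq n X {?t..} + \<eta>" using acc by (auto simp: accurate_at_def)
  moreover have "0 \<le> ?p \<mu>" by simp
  ultimately have "tau_under \<alpha> n \<mu> e \<le> emp_freq n X {?t..}" by linarith
  then show ?thesis by (simp add: phi_minus_eq_0_iff)
qed

lemma phi_plus_rejects:
  assumes e: "admissible \<alpha> n \<eta> e" "\<epsilon> \<le> e" and \<mu>: "0 \<le> \<mu>" "\<mu> + r_over \<alpha> n \<mu> e \<le> lam"
    and acc: "accurate_at \<eta> X (t_over \<alpha> n \<mu> e)"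
  shows "phi_plus \<alpha> n X \<mu> e \<noteq> 0"
proof -
  let ?t = "t_over \<alpha> n \<mu> e"
  let ?p = "\<lambda>\<nu>. measure_pmf.prob (poisson \<nu>) {k. real k \<le> ?t}"
  have s: "small_lev \<alpha> n e" "\<eta> \<le> 5 * sqrt (A_lev \<alpha> n e)" using e by (auto simp: admissible_def)
  have "?p lam \<le> ?p (\<mu> + r_over \<alpha> n \<mu> e)"
    using \<mu> r_over_bounds(1)[OF s(1) \<mu>(1)] by (intro poisson_lower_tail_antimono) auto
  moreover have "measure P {..?t} \<le> ?p lam + \<epsilon>" using P_bounds(2)[of "{..?t}"] by simp
  moreover have "emp_freq n X {..?t} \<le> measure P {..?t} + \<eta>" using acc by (auto simp: accurate_at_def)
  moreover have "\<epsilon> + \<eta> < 10 * sqrt (A_lev \<alpha> n e)" using A_lev_less_sqrt[OF s(1)] le_A_lev[of e] e(2) s(2) by simp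
  moreover have "100 * sqrt (A_lev \<alpha> n e) \<le> ?p (\<mu> + r_over \<alpha> n \<mu> e)"
    by (rule poisson_lower_tail_margin[OF s(1) \<mu>(1)])
  ultimately have "emp_freq n X {..?t} < tau_over \<alpha> n \<mu> e" unfolding tau_over_def by linarith
  then show ?thesis by (simp add: phi_plus_eq_0_iff)
qed

lemma phi_minus_rejects:
  assumes e: "admissible \<alpha> n \<eta> e" "\<epsilon> \<le> e" and \<mu>: "1 \<le> \<mu>" "lam \<le> \<mu> - r_under \<alpha> n \<mu> e"
    and acc: "accurate_at \<eta> X (t_under \<alpha> n \<mu> e)"
  shows "phi_minus \<alpha> n X \<mu> e \<noteq> 0"
proof -
  let ?t = "t_under \<alpha> n \<mu> e"
  let ?p = "\<lambda>\<nu>. measure_pmf.prob (poisson \<nu>) {k. ?t \<le> real k}"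
  have s: "small_lev \<alpha> n e" "\<eta> \<le> 5 * sqrt (A_lev \<alpha> n e)" using e by (auto simp: admissible_def)
  have "?p lam \<le> ?p (\<mu> - r_under \<alpha> n \<mu> e)"
    using \<mu> lam by (intro poisson_upper_tail_mono) auto
  moreover have "measure P {?t..} \<le> ?p lam + \<epsilon>" using P_bounds(2)[of "{?t..}"] by simp
  moreover have "emp_freq n X {?t..} \<le> measure P {?t..} + \<eta>" using acc by (auto simp: accurate_at_def)
  moreover have "\<epsilon> + \<eta> < 10 * sqrt (A_lev \<alpha> n e)" using A_lev_less_sqrt[OF s(1)] le_A_lev[of e] e(2) s(2) by simp
  moreover have "100 * sqrt (A_lev \<alpha> n e) \<le> ?p (\<mu> - r_under \<alpha> n \<mu> e)"
    by (rule poisson_upper_tail_margin[OF s(1) \<mu>(1)])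
  moreover have "tau_under \<alpha> n \<mu> e = 11 / 10 * ?p (\<mu> - r_under \<alpha> n \<mu> e)" using \<mu> by (simp add: tau_under_def)
  ultimately have "emp_freq n X {?t..} < tau_under \<alpha> n \<mu> e" by linarith
  then show ?thesis by (simp add: phi_minus_eq_0_iff)
qed

lemma admissible_le: "admissible \<alpha> n \<eta> e \<Longrightarrow> \<eta> \<le> 1 / 20"
proof -
  assume e: "admissible \<alpha> n \<eta> e"
  then have "100 * sqrt (A_lev \<alpha> n e)
      \<le> measure_pmf.prob (poisson (0 + r_over \<alpha> n 0 e)) {k. real k \<le> t_over \<alpha> n 0 e}"
    by (intro poisson_lower_tail_margin) (auto simp: admissible_def)
  also have "\<dots> \<le> 1" by simp
  finally show ?thesis using e by (simp add: admissible_def)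
qed

lemma lam_le_lam_max:
  assumes "accurate_at \<eta> X (lam - 1)" "\<eta> \<le> 1 / 20"
  shows "lam \<le> lam_max n X"
proof (rule le_lam_maxI[OF n])
  have half: "1 / 2 \<le> measure_pmf.prob (poisson lam) {k. lam - 1 \<le> real k}"
  proof (cases "lam \<le> 1")
    case True
    then have "{k. lam - 1 \<le> real k} = UNIV" by (auto intro: order_trans[of _ 0])
    then show ?thesis by simp
  next
    case False
    define k where "k = nat \<lfloor>lam\<rfloor>"
    have k: "1 \<le> k" "real k \<le> lam" "lam - 1 \<le> real k" using False unfolding k_def by linarith+
    have "1 / 2 \<le> measure_pmf.prob (poisson (real k)) {j. k \<le> j}"
      by (rule poisson_ge_mean_ge_half[OF k(1)])
    also have "\<dots> \<le> measure_pmf.prob (poisson (real k)) {j. lam - 1 \<le> real j}"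
      using k by (intro measure_pmf.finite_measure_mono) auto
    also have "\<dots> \<le> measure_pmf.prob (poisson lam) {j. lam - 1 \<le> real j}"
      using k by (intro poisson_upper_tail_mono) auto
    finally show ?thesis .
  qed
  have "99 / 100 * measure_pmf.prob (poisson lam) {k. lam - 1 \<le> real k} \<le> measure P {lam - 1..}"
    using P_bounds(1)[of "{lam - 1..}"] by simp
  moreover have "measure P {lam - 1..} \<le> emp_freq n X {lam - 1..} + \<eta>"
    using assms by (auto simp: accurate_at_def)
  moreover have "emp_freq n X {lam - 1..} = 1 - emp_freq n X {..<lam - 1}"
    using n by (intro emp_freq_ge) simp
  ultimately show "emp_freq n X {..<lam - 1} < 3 / 4" using half assms(2) by linarith
qed

text \<open>Coverage on the good event. No relation between the levels and the true \<open>\<epsilon>\<close> is needed.\<close>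

lemma lam_in_CI_hat:
  assumes adm: "\<And>e. e \<in> eps_grid \<alpha> n \<epsilon>max \<Longrightarrow> admissible \<alpha> n \<eta> e"
    and acc: "\<And>t. t \<in> test_points (eps_grid \<alpha> n \<epsilon>max) \<Longrightarrow> accurate_at \<eta> X t"
    and low: "lam < 1 \<Longrightarrow> 1 / 2 * (1 - exp (- lam)) - 3 * L / real n \<le> emp_freq n X {1..}"
  shows "lam \<in> CI_hat \<alpha> n \<epsilon>max X"
proof -
  have "\<epsilon>max \<in> eps_grid \<alpha> n \<epsilon>max" by (simp add: eps_grid_def)
  then have \<eta>: "\<eta> \<le> 1 / 20" using adm admissible_le by blast
  have max: "lam \<le> lam_max n X" by (rule lam_le_lam_max[OF acc \<eta>]) auto
  have "psi_plus \<alpha> n X lam e = 0" if e: "e \<in> eps_grid \<alpha> n \<epsilon>max" for e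
  proof -
    define \<mu> where "\<mu> = nat \<lceil>lam\<rceil>"
    have \<mu>: "int \<mu> = \<lceil>lam\<rceil>" using lam by (simp add: \<mu>_def)
    then have "lam \<le> real \<mu>" by linarith
    then have "phi_plus \<alpha> n X (real \<mu>) e = 0" using adm acc e by (intro phi_plus_accepts) auto
    then show ?thesis unfolding psi_plus_eq_0_iff using \<mu> by (intro disjI2 exI[of _ \<mu>]) simp
  qed
  moreover have "psi_minus \<alpha> n X lam e = 0" if e: "e \<in> eps_grid \<alpha> n \<epsilon>max" for e
  proof (cases "lam < 1")
    case True
    then have "phi_minus \<alpha> n X lam e = 0"
      using low by (simp add: phi_minus_eq_0_iff tau_under_def t_under_def)
    then show ?thesis using True by (simp add: psi_minus_eq_0_iff)
  next
    case False
    define \<mu> where "\<mu> = nat \<lfloor>lam\<rfloor>"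
    have \<mu>: "int \<mu> = \<lfloor>lam\<rfloor>" "1 \<le> \<mu>" "real \<mu> \<le> lam" using False unfolding \<mu>_def by linarith+
    then have "phi_minus \<alpha> n X (real \<mu>) e = 0" using adm acc e by (intro phi_minus_accepts) auto
    then show ?thesis unfolding psi_minus_eq_0_iff using \<mu> max by (intro disjI2 exI[of _ \<mu>]) simp
  qed
  ultimately show ?thesis using lam max by (simp add: CI_hat_def)
qed

text \<open>Consequences of the rejections at one level \<open>e\<close> that is at least the true contamination.\<close>

context
  fixes \<epsilon>max \<eta> e X
  assumes e: "e \<in> eps_grid \<alpha> n \<epsilon>max" "admissible \<alpha> n \<eta> e" "\<epsilon> \<le> e"
    and acc: "\<And>t. t \<in> test_points (eps_grid \<alpha> n \<epsilon>max) \<Longrightarrow> accurate_at \<eta> X t"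
begin

lemma CI_hat_lower:
  assumes x: "x \<in> CI_hat \<alpha> n \<epsilon>max X"
  shows "lam - 2 - 2 * (sqrt lam / sqrt (log_lev \<alpha> n e)) \<le> x"
proof (rule ccontr)
  assume less: "\<not> ?thesis"
  have s: "small_lev \<alpha> n e" using e by (simp add: admissible_def)
  have l: "40 \<le> sqrt (log_lev \<alpha> n e)" by (rule small_levD(3)[OF s])
  have nn: "0 \<le> sqrt lam / sqrt (log_lev \<alpha> n e)" using lam small_levD(1)[OF s] by (intro divide_nonneg_nonneg) auto
  have "lam \<le> lam_max n X" using acc admissible_le[OF e(2)] by (intro lam_le_lam_max) auto
  then have "x < lam_max n X" using less nn by linarith
  moreover have "psi_plus \<alpha> n X x e = 0" "0 \<le> x" using x e(1) by (auto simp: CI_hat_def)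
  ultimately obtain \<mu> where \<mu>: "int \<mu> \<le> \<lceil>x\<rceil>" "phi_plus \<alpha> n X (real \<mu>) e = 0"
    by (auto simp: psi_plus_eq_0_iff)
  have "real \<mu> \<le> x + 1" using \<mu>(1) by linarith
  then have "real \<mu> \<le> lam" using less nn by linarith
  then have "sqrt (real \<mu>) / sqrt (log_lev \<alpha> n e) \<le> sqrt lam / sqrt (log_lev \<alpha> n e)"
    using small_levD(1)[OF s] by (intro divide_right_mono) auto
  then have "real \<mu> + r_over \<alpha> n (real \<mu>) e \<le> lam"
    using r_over_bounds(2)[OF s, of "real \<mu>"] \<open>real \<mu> \<le> x + 1\<close> less by simp
  then show False using phi_plus_rejects[OF e(2,3), of "real \<mu>" X] acc[OF test_points(2)[OF e(1)]] \<mu>(2) by simp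
qed

text \<open>If \<open>x \<ge> 1\<close> lies in the interval, then some \<open>\<mu> \<ge> \<lfloor>x\<rfloor> > x - 1\<close> is accepted, so not all such \<open>\<mu>\<close> can lie in
  the region of certain rejection.\<close>

lemma CI_hat_upper_aux:
  assumes x: "x \<in> CI_hat \<alpha> n \<epsilon>max X"
    and rej: "\<And>\<mu>. 1 \<le> \<mu> \<Longrightarrow> x - 1 \<le> \<mu> \<Longrightarrow> lam \<le> \<mu> - r_under \<alpha> n \<mu> e"
    and "1 \<le> x"
  shows False
proof -
  have "psi_minus \<alpha> n X x e = 0" using x e(1) by (auto simp: CI_hat_def)
  then obtain \<mu> where \<mu>: "1 \<le> \<mu>" "\<lfloor>x\<rfloor> \<le> int \<mu>" "phi_minus \<alpha> n X (real \<mu>) e = 0"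
    using \<open>1 \<le> x\<close> by (auto simp: psi_minus_eq_0_iff)
  then have "lam \<le> real \<mu> - r_under \<alpha> n (real \<mu>) e" by (intro rej) (simp, linarith)
  then show False using phi_minus_rejects[OF e(2,3), of "real \<mu>" X] acc[OF test_points(3)[OF e(1)]] \<mu> by simp
qed

lemma CI_hat_upper_linear:
  assumes x: "x \<in> CI_hat \<alpha> n \<epsilon>max X"
  shows "x \<le> 2 * lam + 1"
proof (rule ccontr)
  assume "\<not> ?thesis"
  then have less: "2 * lam + 1 < x" by simp
  have s: "small_lev \<alpha> n e" using e by (simp add: admissible_def)
  show False
  proof (rule CI_hat_upper_aux[OF x])
    fix \<mu> :: real assume "1 \<le> \<mu>" "x - 1 \<le> \<mu>"
    then show "lam \<le> \<mu> - r_under \<alpha> n \<mu> e" using r_under_bounds(3)[OF s, of \<mu>] less by simp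
  qed (use less lam in simp)
qed

lemma CI_hat_upper:
  assumes x: "x \<in> CI_hat \<alpha> n \<epsilon>max X"
  shows "x \<le> lam + 2 + 4 * (sqrt lam / sqrt (log_lev \<alpha> n e))"
proof (rule ccontr)
  assume "\<not> ?thesis"
  then have less: "lam + 2 + 4 * (sqrt lam / sqrt (log_lev \<alpha> n e)) < x" by simp
  have s: "small_lev \<alpha> n e" using e by (simp add: admissible_def)
  have l: "40 \<le> sqrt (log_lev \<alpha> n e)" by (rule small_levD(3)[OF s])
  have nn: "0 \<le> sqrt lam / sqrt (log_lev \<alpha> n e)" using lam small_levD(1)[OF s] by (intro divide_nonneg_nonneg) auto
  show False
  proof (rule CI_hat_upper_aux[OF x])
    fix \<mu> :: real assume \<mu>: "1 \<le> \<mu>" "x - 1 \<le> \<mu>"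
    note r = r_under_bounds[OF s \<mu>(1)]
    show "lam \<le> \<mu> - r_under \<alpha> n \<mu> e"
    proof (cases "2 * lam \<le> \<mu>")
      case True
      then show ?thesis using r(3) by simp
    next
      case False
      then have "sqrt \<mu> \<le> sqrt (4 * lam)" using lam by simp
      also have "\<dots> = 2 * sqrt lam" by (simp add: real_sqrt_mult)
      finally have "sqrt \<mu> / sqrt (log_lev \<alpha> n e) \<le> 2 * sqrt lam / sqrt (log_lev \<alpha> n e)"
        using small_levD(1)[OF s] by (intro divide_right_mono) auto
      then show ?thesis using r(2) \<mu>(2) less by simp
    qed
  qed (use less lam nn in simp)
qed

text \<open>Below \<open>1\<close> the test of \<open>psi_minus\<close> compares the frequency of observations that are at least \<open>1\<close> with
  half of \<open>1 - exp (- x) \<ge> x / 2\<close>, lowered by \<open>3 L / n\<close>.\<close>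

lemma CI_hat_upper_small:
  assumes x: "x \<in> CI_hat \<alpha> n \<epsilon>max X" and small: "lam \<le> 1 / 2"
    and high: "emp_freq n X {1..} \<le> 2 * (lam + \<epsilon>) + L / real n"
  shows "x \<le> 8 * (lam + \<epsilon>) + 16 * (L / real n)"
proof -
  have s: "small_lev \<alpha> n e" using e by (simp add: admissible_def)
  have rej: "lam \<le> \<mu> - r_under \<alpha> n \<mu> e" if "1 \<le> \<mu>" for \<mu>
    using r_under_bounds(3)[OF s that] that small by simp
  have x0: "0 \<le> x" using x by (simp add: CI_hat_def)
  have x1: "x < 1" using CI_hat_upper_aux[OF x rej] by force
  have "psi_minus \<alpha> n X x e = 0" using x e(1) by (auto simp: CI_hat_def)
  moreover have "phi_minus \<alpha> n X (real \<mu>) e \<noteq> 0" if "1 \<le> \<mu>" for \<mu>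
    using phi_minus_rejects[OF e(2,3), of "real \<mu>" X] rej[of "real \<mu>"]
      acc[OF test_points(3)[OF e(1)]] that by simp
  ultimately have "phi_minus \<alpha> n X x e = 0" unfolding psi_minus_eq_0_iff by (metis neq0_conv)
  then have "1 / 2 * (1 - exp (- x)) - 3 * L / real n \<le> emp_freq n X {1..}"
    using x1 by (simp add: phi_minus_eq_0_iff tau_under_def t_under_def)
  moreover have "exp (- x) \<le> 1 - x / 2"
  proof -
    have "1 \<le> (1 - x / 2) * (1 + x)"
      using x0 x1 mult_right_mono[of x 1 x] by (simp add: algebra_simps)
    also have "\<dots> \<le> (1 - x / 2) * exp x"
      using x1 by (intro mult_left_mono exp_ge_add_one_self) auto
    finally show ?thesis by (simp add: exp_minus field_simps)
  qed
  ultimately show ?thesis using high by (simp add: field_simps)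
qed

end

end

section \<open>Probability of good samples\<close>

lemma (in prob_space) prob_ge_one_minus:
  assumes "G \<in> events" "N1 \<in> events" "N2 \<in> events" "prob N1 + prob N2 \<le> \<delta>"
    and "\<And>X. X \<in> space M \<Longrightarrow> X \<notin> N1 \<Longrightarrow> X \<notin> N2 \<Longrightarrow> X \<in> G"
  shows "1 - \<delta> \<le> prob G"
proof -
  have "1 - prob G = prob (space M - G)" using assms(1) by (rule prob_compl[symmetric])
  also have "\<dots> \<le> prob (N1 \<union> N2)" using assms by (intro finite_measure_mono) auto
  also have "\<dots> \<le> prob N1 + prob N2" using assms by (intro measure_Un_le) auto
  finally show ?thesis using assms(4) by linarith
qed

context contaminated_sample
begin

lemma prob_space_P: "prob_space P"
  using \<epsilon> Q by (intro prob_space_contaminated_poisson) (auto simp: prob_distributions_def)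

lemma prob_space_S: "prob_space S"
  unfolding sample_law_def by (intro prob_space_PiM prob_space_P)

lemma accurate_with_high_probability:
  assumes "countable E" "m > 0"
    and budget: "2 * (real (m + 1) * exp (- (real n / (4 * (real m)\<^sup>2)))) \<le> \<delta>"
  obtains N where "N \<in> sets S" "measure S N \<le> \<delta>"
    "\<And>X t. X \<in> space S \<Longrightarrow> X \<notin> N \<Longrightarrow> t \<in> test_points E \<Longrightarrow> accurate_at (2 / real m) X t"
proof -
  interpret P: prob_space P by (rule prob_space_P)
  let ?C = "atMost ` test_points E \<union> lessThan ` test_points E"
  have c: "countable ?C" using assms(1) by (auto simp: test_points_def)
  obtain N where N: "N \<in> sets S" "measure S N \<le> 2 * (real (m + 1) * exp (- (real n / (4 * (real m)\<^sup>2))))"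
    "\<And>X B. X \<in> space S - N \<Longrightarrow> B \<in> ?C \<Longrightarrow> \<bar>emp_freq n X B - measure P B\<bar> \<le> 2 / real m"
  proof (rule P.emp_freq_chain_deviation[OF c])
    show "?C \<subseteq> P.events" by auto
    have down: "x \<in> A" if "A \<in> ?C" "y \<in> A" "x \<le> y" for A and x y :: real
      using that by auto
    show "A \<subseteq> B \<or> B \<subseteq> A" if "A \<in> ?C" "B \<in> ?C" for A B
      using down[OF that(1)] down[OF that(2)] by (meson linear subsetI)
    show "0 < n" "0 < m" using n assms by auto
  qed (use that in \<open>auto simp: sample_law_def\<close>)
  show thesis
  proof (rule that[OF N(1) order_trans[OF N(2) budget]])
    fix X t assume X: "X \<in> space S" "X \<notin> N" and t: "t \<in> test_points E"
    have "space P - {..<t} = {t..}" by auto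
    then have "measure P {t..} = 1 - measure P {..<t}" using P.prob_compl[of "{..<t}"] by simp
    moreover have "emp_freq n X {t..} = 1 - emp_freq n X {..<t}" using n by (intro emp_freq_ge) simp
    ultimately show "accurate_at (2 / real m) X t"
      using N(3)[of X "{..t}"] N(3)[of X "{..<t}"] X t by (auto simp: accurate_at_def)
  qed
qed

lemma exp_minus_L: "exp (- L) = \<alpha> / 24"
  using \<alpha> by (simp add: exp_minus)

lemma poisson_ge_one: "measure_pmf.prob (poisson lam) {k. real k \<in> {1..}} = 1 - exp (- lam)"
proof -
  have "{k. real k \<in> {1..}} = UNIV - {0}" by (auto simp: not_less_eq_eq Suc_le_eq)
  then show ?thesis using measure_pmf.prob_compl[of "{0}" "poisson lam"] lam
    by (simp add: measure_pmf_single pmf_poisson_nonneg)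
qed

text \<open>Chernoff's bound with \<open>\<theta> = -1\<close>; the term \<open>3 L / n\<close> in the critical value yields the exponent.\<close>

lemma prob_few_positive:
  "measure S {X \<in> space S. \<not> 1 / 2 * (1 - exp (- lam)) - 3 * L / real n \<le> emp_freq n X {1..}} \<le> \<alpha> / 24"
proof -
  interpret P: prob_space P by (rule prob_space_P)
  interpret S: prob_space S by (rule prob_space_S)
  let ?q = "1 - exp (- lam)"
  let ?y = "- (real n * (1 / 2 * ?q - 3 * L / real n))"
  have q: "0 \<le> ?q" using lam by simp
  have meas: "(\<lambda>X. emp_freq n X {1..}) \<in> borel_measurable S"
    unfolding sample_law_def by (rule emp_freq_measurable) simp
  have "measure S {X \<in> space S. \<not> 1 / 2 * ?q - 3 * L / real n \<le> emp_freq n X {1..}}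
      \<le> measure S {X \<in> space S. ?y \<le> (- 1) * (real n * emp_freq n X {1..})}"
    using meas n by (intro S.finite_measure_mono) auto
  also have "\<dots> \<le> exp (real n * measure P {1..} * (exp (- 1) - 1) - ?y)"
    unfolding sample_law_def using n by (intro P.emp_freq_chernoff) auto
  also have "\<dots> \<le> exp (- L)"
  proof -
    have e: "exp (- 1) - 1 \<le> (- (3 / 5) :: real)"
      using exp_lower_Taylor_quadratic[of "1 :: real"] by (simp add: exp_minus field_simps)
    have p: "99 / 100 * ?q \<le> measure P {1..}" using P_bounds(1)[of "{1..}"] poisson_ge_one by simp
    have "real n * measure P {1..} * (exp (- 1) - 1) \<le> real n * measure P {1..} * (- (3 / 5))"
      using e by (intro mult_left_mono) auto
    also have "\<dots> \<le> real n * (99 / 100 * ?q) * (- (3 / 5))"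
      using p by (intro mult_right_mono_neg mult_left_mono) auto
    finally have "real n * measure P {1..} * (exp (- 1) - 1) - ?y \<le> - (3 * L) - 94 / 1000 * (real n * ?q)"
      using n unfolding right_diff_distrib by (simp add: field_simps)
    moreover have "0 \<le> real n * ?q" using q by (intro mult_nonneg_nonneg) auto
    ultimately show ?thesis using L_ge_3 by simp
  qed
  finally show ?thesis by (simp add: exp_minus_L)
qed

text \<open>Chernoff's bound with \<open>\<theta> = 1\<close>, using \<open>exp 1 - 1 \<le> 2\<close>.\<close>

lemma prob_many_positive:
  "measure S {X \<in> space S. \<not> emp_freq n X {1..} \<le> 2 * (lam + \<epsilon>) + L / real n} \<le> \<alpha> / 24"
proof -
  interpret P: prob_space P by (rule prob_space_P)
  interpret S: prob_space S by (rule prob_space_S)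
  let ?y = "real n * (2 * (lam + \<epsilon>) + L / real n)"
  have meas: "(\<lambda>X. emp_freq n X {1..}) \<in> borel_measurable S"
    unfolding sample_law_def by (rule emp_freq_measurable) simp
  have "measure S {X \<in> space S. \<not> emp_freq n X {1..} \<le> 2 * (lam + \<epsilon>) + L / real n}
      \<le> measure S {X \<in> space S. ?y \<le> 1 * (real n * emp_freq n X {1..})}"
    using meas n by (intro S.finite_measure_mono) auto
  also have "\<dots> \<le> exp (real n * measure P {1..} * (exp 1 - 1) - ?y)"
    unfolding sample_law_def using n by (intro P.emp_freq_chernoff) auto
  also have "\<dots> \<le> exp (- L)"
  proof -
    have p: "measure P {1..} \<le> lam + \<epsilon>"
      using P_bounds(2)[of "{1..}"] poisson_ge_one exp_ge_add_one_self[of "- lam"] by simp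
    have "measure P {1..} * (exp 1 - 1) \<le> (lam + \<epsilon>) * 2"
      using p exp_le lam \<epsilon> by (intro mult_mono) auto
    then have "real n * (measure P {1..} * (exp 1 - 1)) \<le> real n * ((lam + \<epsilon>) * 2)"
      by (intro mult_left_mono) auto
    then show ?thesis using n by (simp add: algebra_simps)
  qed
  finally show ?thesis by (simp add: exp_minus_L)
qed

lemma CI_hat_coverage:
  assumes adm: "\<And>e. e \<in> eps_grid \<alpha> n \<epsilon>max \<Longrightarrow> admissible \<alpha> n (2 / real m) e" and m: "m > 0"
    and budget: "2 * (real (m + 1) * exp (- (real n / (4 * (real m)\<^sup>2)))) \<le> \<alpha> / 2"
  shows "1 - \<alpha> \<le> measure S {X \<in> space S. lam \<in> CI_hat \<alpha> n \<epsilon>max X}"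
proof -
  interpret S: prob_space S by (rule prob_space_S)
  obtain N where N: "N \<in> sets S" "measure S N \<le> \<alpha> / 2"
    "\<And>X t. X \<in> space S \<Longrightarrow> X \<notin> N \<Longrightarrow> t \<in> test_points (eps_grid \<alpha> n \<epsilon>max) \<Longrightarrow> accurate_at (2 / real m) X t"
    by (rule accurate_with_high_probability[OF countable_eps_grid[of \<alpha> n \<epsilon>max] m budget]) (rule that)
  let ?N = "{X \<in> space S. \<not> 1 / 2 * (1 - exp (- lam)) - 3 * L / real n \<le> emp_freq n X {1..}}"
  have [measurable]: "(\<lambda>X. emp_freq n X {1..}) \<in> borel_measurable S"
    unfolding sample_law_def by (rule emp_freq_measurable) simp
  show ?thesis
  proof (rule S.prob_ge_one_minus[OF _ N(1), of _ ?N])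
    show "{X \<in> space S. lam \<in> CI_hat \<alpha> n \<epsilon>max X} \<in> sets S"
      unfolding sample_law_def by (rule measurable_CI_hat) (use n in auto)
    show "?N \<in> sets S" by measurable
    show "measure S N + measure S ?N \<le> \<alpha>" using N(2) prob_few_positive \<alpha> by simp
    fix X assume "X \<in> space S" "X \<notin> N" "X \<notin> ?N"
    then show "X \<in> {X \<in> space S. lam \<in> CI_hat \<alpha> n \<epsilon>max X}"
      using N(3) by (auto intro!: lam_in_CI_hat[where \<eta> = "2 / real m"] adm)
  qed
qed

lemma log_terms_nonneg: "0 \<le> 1 / sqrt (ln (real n))" "0 \<le> inv_sqrt_log \<epsilon>"
proof -
  show "0 \<le> 1 / sqrt (ln (real n))" using n by (auto intro!: divide_nonneg_nonneg)
  show "0 \<le> inv_sqrt_log \<epsilon>"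
    using \<epsilon> by (auto simp: inv_sqrt_log_def field_simps intro!: divide_nonneg_nonneg ln_ge_zero)
qed

lemma length_rate_nonneg: "0 \<le> length_rate n \<epsilon> lam"
  unfolding length_rate_def using log_terms_nonneg lam \<epsilon>
  by (intro add_nonneg_nonneg min.boundedI mult_nonneg_nonneg) auto

lemma CI_hat_length:
  assumes adm: "admissible \<alpha> n (2 / real m) e" and m: "m > 0"
    and budget: "2 * (real (m + 1) * exp (- (real n / (4 * (real m)\<^sup>2)))) \<le> \<alpha> / 2"
    and e: "e \<in> eps_grid \<alpha> n \<epsilon>max" "\<epsilon> \<le> e"
    and K: "1 \<le> K" "1 / sqrt (log_lev \<alpha> n e) \<le> K * (1 / sqrt (ln (real n)) + inv_sqrt_log \<epsilon>)"
  defines "C \<equiv> 6 * K + 120 * L"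
  shows "1 - \<alpha> \<le> measure S {X \<in> space S. interval_length (CI_hat \<alpha> n \<epsilon>max X) \<le> C * length_rate n \<epsilon> lam}"
proof -
  interpret S: prob_space S by (rule prob_space_S)
  obtain N where N: "N \<in> sets S" "measure S N \<le> \<alpha> / 2"
    "\<And>X t. X \<in> space S \<Longrightarrow> X \<notin> N \<Longrightarrow> t \<in> test_points (eps_grid \<alpha> n \<epsilon>max) \<Longrightarrow> accurate_at (2 / real m) X t"
    by (rule accurate_with_high_probability[OF countable_eps_grid[of \<alpha> n \<epsilon>max] m budget]) (rule that)
  let ?N = "{X \<in> space S. \<not> emp_freq n X {1..} \<le> 2 * (lam + \<epsilon>) + L / real n}"
  have [measurable]: "(\<lambda>X. emp_freq n X {1..}) \<in> borel_measurable S"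
    unfolding sample_law_def by (rule emp_freq_measurable) simp
  have C: "0 \<le> C" using K L_ge_3 by (simp add: C_def)
  then have CR: "0 \<le> C * length_rate n \<epsilon> lam" using length_rate_nonneg by simp
  define G where "G = 1 / sqrt (ln (real n)) + inv_sqrt_log \<epsilon>"
  have G: "0 \<le> G" using log_terms_nonneg by (simp add: G_def)
  have rate: "length_rate n \<epsilon> lam = min (sqrt lam * G + 1) lam + 1 / real n + \<epsilon>"
    by (simp add: length_rate_def G_def)
  have bound: "y - x \<le> C * length_rate n \<epsilon> lam"
    if X: "X \<in> space S" "X \<notin> N" "X \<notin> ?N" and xy: "x \<in> CI_hat \<alpha> n \<epsilon>max X" "y \<in> CI_hat \<alpha> n \<epsilon>max X" for X x y
  proof -
    have acc: "\<And>t. t \<in> test_points (eps_grid \<alpha> n \<epsilon>max) \<Longrightarrow> accurate_at (2 / real m) X t"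
      using X N(3) by blast
    have x0: "0 \<le> x" using xy by (simp add: CI_hat_def)
    note lower = CI_hat_lower[OF e(1) adm e(2) acc xy(1)]
    note upper = CI_hat_upper[OF e(1) adm e(2) acc xy(2)]
    note upper' = CI_hat_upper_linear[OF e(1) adm e(2) acc xy(2)]
    show ?thesis
    proof (cases "1 \<le> lam")
      case True
      have "sqrt lam / sqrt (log_lev \<alpha> n e) \<le> sqrt lam * (K * G)"
        using mult_left_mono[OF K(2), of "sqrt lam"] lam by (simp add: G_def)
      then have "y - x \<le> 4 + 6 * (sqrt lam * (K * G))" using lower upper by linarith
      also have "\<dots> \<le> 6 * K * (sqrt lam * G + 1)" using K(1) by (simp add: algebra_simps)
      finally have 1: "y - x \<le> 6 * K * (sqrt lam * G + 1)" .
      have "y - x \<le> 3 * lam" using upper' x0 True by simp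
      also have "\<dots> \<le> 6 * K * lam" using K(1) lam by (intro mult_right_mono) auto
      finally have "y - x \<le> 6 * K * min (sqrt lam * G + 1) lam" using 1 by (simp add: min_def)
      also have "\<dots> \<le> C * length_rate n \<epsilon> lam"
        unfolding rate using K(1) L_ge_3 \<epsilon> G lam
        by (intro mult_mono) (auto simp: C_def intro!: add_nonneg_nonneg)
      finally show ?thesis .
    next
      case False
      then have b: "length_rate n \<epsilon> lam = lam + 1 / real n + \<epsilon>"
      proof -
        have "0 \<le> sqrt lam * G" using G lam by simp
        then have "lam \<le> sqrt lam * G + 1" using False by linarith
        then show ?thesis unfolding rate by (simp add: min_def)
      qed
      let ?b = "lam + 1 / real n + \<epsilon>"
      have b0: "0 \<le> ?b" using lam \<epsilon> by simp
      have "y \<le> 120 * L * ?b"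
      proof (cases "1 \<le> 40 * L * ?b")
        case True
        then show ?thesis using upper' False by simp
      next
        case small: False
        have "2 * lam \<le> 40 * L * ?b"
          using L_ge_3 lam \<epsilon> by (intro mult_mono) auto
        then have "lam \<le> 1 / 2" using small by linarith
        then have "y \<le> 8 * (lam + \<epsilon>) + 16 * (L / real n)"
          using X by (intro CI_hat_upper_small[OF e(1) adm e(2) acc xy(2)]) auto
        also have "\<dots> \<le> 16 * L * (lam + \<epsilon>) + 16 * L * (1 / real n)"
          using L_ge_3 lam \<epsilon> by (intro add_mono mult_right_mono) auto
        also have "\<dots> = 16 * L * ?b" by (simp add: algebra_simps)
        also have "\<dots> \<le> 120 * L * ?b" using L_ge_3 b0 by (intro mult_right_mono) auto
        finally show ?thesis .
      qed
      also have "\<dots> \<le> C * ?b" using K(1) b0 by (intro mult_right_mono) (auto simp: C_def)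
      finally show ?thesis using b x0 by simp
    qed
  qed
  show ?thesis
  proof (rule S.prob_ge_one_minus[OF _ N(1), of _ ?N])
    show "{X \<in> space S. interval_length (CI_hat \<alpha> n \<epsilon>max X) \<le> C * length_rate n \<epsilon> lam} \<in> sets S"
      unfolding sample_law_def by (rule measurable_CI_hat_length) (use n CR in auto)
    show "?N \<in> sets S" by measurable
    show "measure S N + measure S ?N \<le> \<alpha>" using N(2) prob_many_positive \<alpha> by simp
    fix X assume "X \<in> space S" "X \<notin> N" "X \<notin> ?N"
    then show "X \<in> {X \<in> space S. interval_length (CI_hat \<alpha> n \<epsilon>max X) \<le> C * length_rate n \<epsilon> lam}"
      unfolding mem_Collect_eq CI_hat_interval_length_le_iff[OF CR] using bound by blast
  qed
qed

end

section \<open>Levels, constants and the final bounds\<close>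

lemma ln_24_div_le:
  fixes \<alpha> :: real
  assumes "0 < \<alpha>" "\<alpha> < 1"
  shows "ln (24 / \<alpha>) \<le> 5 * ln (2 / \<alpha>)"
proof -
  have "ln 12 \<le> ln ((2::real) ^ 4)" by simp
  also have "\<dots> = 4 * ln 2" by (simp add: ln_realpow del: power_numeral)
  also have "\<dots> \<le> 4 * ln (2 / \<alpha>)" using assms by (simp add: field_simps)
  finally have "ln 12 + ln (2 / \<alpha>) \<le> 5 * ln (2 / \<alpha>)" by simp
  moreover have "ln (24 / \<alpha>) = ln 12 + ln (2 / \<alpha>)"
    using assms ln_mult[of 12 "2 / \<alpha>"] by simp
  ultimately show ?thesis by simp
qed

text \<open>The resolution \<open>m\<close> of the uniform deviation bound is the integer part of the fourth root of \<open>n / L\<close>.\<close>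

lemma exists_fourth_root_nat:
  assumes "4096 \<le> (x :: real)"
  obtains m :: nat where "7 \<le> m" "real m ^ 4 \<le> x" "x \<le> 16 * real m ^ 4"
proof -
  define r where "r = root 4 x"
  have r4: "r ^ 4 = x" using assms by (simp add: r_def)
  have "8 \<le> r"
  proof (rule power_le_imp_le_base[of _ 3])
    show "8 ^ Suc 3 \<le> r ^ Suc 3" using r4 assms by simp
  qed (use assms in \<open>simp add: r_def\<close>)
  define m where "m = nat \<lfloor>r\<rfloor>"
  have m: "7 \<le> m" "real m \<le> r" "r \<le> 2 * real m" using \<open>8 \<le> r\<close> unfolding m_def by linarith+
  have "real m ^ 4 \<le> r ^ 4" using m by (intro power_mono) auto
  moreover have "r ^ 4 \<le> (2 * real m) ^ 4" using m \<open>8 \<le> r\<close> by (intro power_mono) auto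
  ultimately show thesis using m(1) r4 by (intro that) (auto simp: power_mult_distrib)
qed

lemma deviation_budget:
  fixes \<alpha> :: real
  assumes \<alpha>: "0 < \<alpha>" and L: "3 \<le> ln (24 / \<alpha>)" and m: "7 \<le> m" "real m ^ 4 \<le> real n / ln (24 / \<alpha>)"
  shows "2 * (real (m + 1) * exp (- (real n / (4 * (real m)\<^sup>2)))) \<le> \<alpha> / 2"
proof -
  let ?L = "ln (24 / \<alpha>)"
  have "?L * (real m ^ 4) \<le> real n" using m(2) L by (simp add: pos_le_divide_eq mult.commute)
  then have "?L * ((real m)\<^sup>2 / 4) \<le> real n / (4 * (real m)\<^sup>2)"
    using m(1) by (simp add: field_simps power2_eq_square power4_eq_xxxx)
  moreover have "?L + real m \<le> ?L * ((real m)\<^sup>2 / 4)"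
  proof -
    have "7 * real m \<le> (real m)\<^sup>2" using m(1) by (simp add: power2_eq_square)
    then have mm: "real m \<le> 3 * ((real m)\<^sup>2 / 4 - 1)" "0 \<le> (real m)\<^sup>2 / 4 - 1" using m(1) by simp_all
    then have "real m \<le> ?L * ((real m)\<^sup>2 / 4 - 1)"
      using L by (intro order_trans[OF mm(1)] mult_right_mono) auto
    then show ?thesis by (simp add: algebra_simps)
  qed
  ultimately have "exp (- (real n / (4 * (real m)\<^sup>2))) \<le> exp (- (?L + real m))" by simp
  also have "\<dots> = exp (- ?L) * exp (- real m)" by (simp flip: exp_add)
  also have "exp (- ?L) = \<alpha> / 24" using \<alpha> by (simp add: exp_minus)
  finally have "real (m + 1) * exp (- (real n / (4 * (real m)\<^sup>2))) \<le> \<alpha> / 24 * (real (m + 1) * exp (- real m))"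
    by (simp add: mult_left_mono mult.left_commute)
  also have "real (m + 1) * exp (- real m) \<le> 1"
    using exp_ge_add_one_self[of "real m"] by (simp add: exp_minus field_simps)
  finally show ?thesis using \<alpha> by simp
qed

lemma small_lev_of_small:
  assumes "0 \<le> e" "e \<le> exp (- 4000) / 9" "0 < ln (24 / \<alpha>) / real n" "ln (24 / \<alpha>) / real n \<le> 5 / 9 * exp (- 4000)"
  shows "small_lev \<alpha> n e"
proof -
  have sq: "(exp (- 2000) :: real)\<^sup>2 = exp (- 4000)" by (simp add: power2_eq_square flip: exp_add)
  have "ln (24 / \<alpha>) / (2 * real n) = ln (24 / \<alpha>) / real n / 2" by simp
  also have "\<dots> \<le> 5 / 9 * exp (- 4000) / 2" by (rule divide_right_mono[OF assms(4)]) simp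
  also have "\<dots> \<le> (6 / 10 * exp (- 2000))\<^sup>2" unfolding power_mult_distrib sq by (simp add: power2_eq_square)
  finally have "sqrt (ln (24 / \<alpha>) / (2 * real n)) \<le> 6 / 10 * exp (- 2000)"
    by (intro real_le_lsqrt) simp_all
  moreover have "e \<le> 1 / 9 * exp (- 2000)"
    by (rule order_trans[OF assms(2)]) simp
  moreover have "0 < sqrt (ln (24 / \<alpha>) / (2 * real n))" using assms(3) by (simp add: zero_less_divide_iff)
  ultimately show ?thesis
    using assms(1) unfolding small_lev_def A_lev_def by (auto intro: add_nonneg_pos)
qed

lemma admissible_of_small_lev:
  assumes s: "small_lev \<alpha> n e" and "0 \<le> e" and L: "0 < ln (24 / \<alpha>)" and n: "1 \<le> n"
    and m: "0 < m" "real n / ln (24 / \<alpha>) \<le> 16 * real m ^ 4"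
  shows "admissible \<alpha> n (2 / real m) e"
proof -
  let ?L = "ln (24 / \<alpha>)"
  have A: "sqrt (?L / (2 * real n)) \<le> A_lev \<alpha> n e" "0 < A_lev \<alpha> n e"
    using assms by (auto simp: A_lev_def small_lev_def)
  then have "(sqrt (?L / (2 * real n)))\<^sup>2 \<le> (A_lev \<alpha> n e)\<^sup>2"
    using L by (intro power_mono) auto
  then have A2: "?L / (2 * real n) \<le> (A_lev \<alpha> n e)\<^sup>2" using L by simp
  \<comment> \<open>The fourth powers are compared: \<open>256 L / n \<le> 625 L / (2 n) \<le> 625 A\<^sup>2\<close>.\<close>
  have "2 / real m \<le> 5 * sqrt (A_lev \<alpha> n e)"
  proof (rule power_le_imp_le_base[of _ 3])
    have "(2 / real m) ^ Suc 3 = 16 / real m ^ 4" by (simp add: power_divide)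
    also have "\<dots> \<le> 256 * (?L / real n)"
      using m L n by (simp add: field_simps)
    also have "\<dots> \<le> 625 * (?L / (2 * real n))" using L n by (simp add: field_simps)
    also have "\<dots> \<le> 625 * (A_lev \<alpha> n e)\<^sup>2" using A2 by simp
    also have "\<dots> = (5 * sqrt (A_lev \<alpha> n e)) ^ Suc 3"
    proof -
      have "sqrt (A_lev \<alpha> n e) ^ 4 = ((sqrt (A_lev \<alpha> n e))\<^sup>2)\<^sup>2" by (simp flip: power_mult)
      also have "\<dots> = (A_lev \<alpha> n e)\<^sup>2" using A(2) by simp
      finally show ?thesis by (simp add: power_mult_distrib)
    qed
    finally show "(2 / real m) ^ Suc 3 \<le> (5 * sqrt (A_lev \<alpha> n e)) ^ Suc 3" .
  qed (use A in simp)
  then show ?thesis using s by (simp add: admissible_def)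
qed

lemma eps_grid_bounds:
  assumes "0 \<le> \<epsilon>max" "0 < ln (24 / \<alpha>)" "1 \<le> n" "e \<in> eps_grid \<alpha> n \<epsilon>max"
  shows "0 \<le> e" "e \<le> \<epsilon>max"
proof -
  let ?L = "ln (24 / \<alpha>)"
  have "0 \<le> e \<and> e \<le> \<epsilon>max"
  proof (cases "e = \<epsilon>max")
    case False
    then obtain k :: nat where k: "e = 2 ^ k * ?L / real n" "\<epsilon>max \<noteq> 0"
        "int k \<le> \<lfloor>log 2 (real n * \<epsilon>max / ?L)\<rfloor>"
      using assms(4) by (auto simp: eps_grid_def)
    then have "real k \<le> log 2 (real n * \<epsilon>max / ?L)" by linarith
    then have "2 ^ k \<le> real n * \<epsilon>max / ?L"
      using assms k(2) by (simp add: le_log_iff powr_realpow)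
    then have "2 ^ k * ?L \<le> \<epsilon>max * real n" using assms by (simp add: pos_le_divide_eq mult.commute)
    then have "e \<le> \<epsilon>max" using assms unfolding k(1) by (simp add: pos_divide_le_eq)
    moreover have "0 \<le> e" using assms unfolding k(1) by simp
    ultimately show ?thesis by simp
  qed (use assms in simp)
  then show "0 \<le> e" "e \<le> \<epsilon>max" by auto
qed

text \<open>The least dyadic level above \<open>\<epsilon>\<close> is used, or \<open>\<epsilon>max\<close> if that level is not in the grid.\<close>

lemma eps_grid_dominates:
  assumes "0 \<le> \<epsilon>" "\<epsilon> \<le> \<epsilon>max" "0 < ln (24 / \<alpha>)" "1 \<le> n"
  obtains e where "e \<in> eps_grid \<alpha> n \<epsilon>max" "\<epsilon> \<le> e" "e \<le> max (2 * \<epsilon>) (ln (24 / \<alpha>) / real n)"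
proof (cases "\<epsilon>max \<le> ln (24 / \<alpha>) / real n")
  case True
  then show thesis using assms by (intro that[of \<epsilon>max]) (auto simp: eps_grid_def)
next
  case False
  let ?u = "ln (24 / \<alpha>) / real n"
  have u: "0 < ?u" using assms by simp
  obtain k0 where "\<epsilon> / ?u < 2 ^ k0" using real_arch_pow[of 2 "\<epsilon> / ?u"] by auto
  then have ex: "\<epsilon> \<le> 2 ^ k0 * ?u" unfolding pos_divide_less_eq[OF u] by (rule less_imp_le)
  define k where "k = (LEAST k. \<epsilon> \<le> 2 ^ k * ?u)"
  have k: "\<epsilon> \<le> 2 ^ k * ?u" unfolding k_def by (rule LeastI) (rule ex)
  have k': "2 ^ k * ?u \<le> max (2 * \<epsilon>) ?u"
  proof (cases k)
    case (Suc j)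
    have "\<not> \<epsilon> \<le> 2 ^ j * ?u" using Suc unfolding k_def by (intro not_less_Least) simp
    then show ?thesis using Suc by simp
  qed simp
  show thesis
  proof (cases "2 ^ k * ?u \<le> \<epsilon>max")
    case True
    have "2 ^ k \<le> real n * \<epsilon>max / ln (24 / \<alpha>)" using True assms by (simp add: field_simps)
    moreover have "0 < \<epsilon>max" using False u by linarith
    ultimately have "real k \<le> log 2 (real n * \<epsilon>max / ln (24 / \<alpha>))"
      using assms by (simp add: le_log_iff powr_realpow)
    then have "int k \<le> \<lfloor>log 2 (real n * \<epsilon>max / ln (24 / \<alpha>))\<rfloor>" by (simp add: le_floor_iff)
    then have "2 ^ k * ?u \<in> eps_grid \<alpha> n \<epsilon>max" using \<open>0 < \<epsilon>max\<close> by (auto simp: eps_grid_def)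
    then show thesis using k k' by (intro that)
  next
    case False
    then show thesis using k' assms \<open>\<not> \<epsilon>max \<le> ?u\<close>
      by (intro that[of \<epsilon>max]) (auto simp: eps_grid_def)
  qed
qed

text \<open>For \<open>x = n / L\<close>, \<open>A \<le> 2 \<epsilon> + 2 / sqrt x\<close>, and the larger term decides. If it is the first, then \<open>A \<le> sqrt \<epsilon>\<close>.
  Otherwise \<open>A \<le> x powr (-1/4)\<close>, and \<open>ln n \<le> (1 + ln L) ln x\<close> is where the constant depends on \<open>\<alpha>\<close>.\<close>

lemma inverse_sqrt_log_lev_le:
  assumes s: "small_lev \<alpha> n e" and \<epsilon>: "0 \<le> \<epsilon>" "\<epsilon> \<le> 1 / 16" and L: "3 \<le> ln (24 / \<alpha>)" and n: "1 \<le> n"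
    and x: "256 \<le> real n / ln (24 / \<alpha>)" and e: "e \<le> max (2 * \<epsilon>) (ln (24 / \<alpha>) / real n)"
  shows "1 / sqrt (log_lev \<alpha> n e)
      \<le> 2 * sqrt (1 + ln (ln (24 / \<alpha>))) * (1 / sqrt (ln (real n)) + inv_sqrt_log \<epsilon>)"
proof -
  define L where "L = ln (24 / \<alpha>)"
  define x where "x = real n / L"
  define K where "K = 2 * sqrt (1 + ln L)"
  have L3: "3 \<le> L" and x256: "256 \<le> x" using L x by (simp_all add: L_def x_def)
  have lnL: "0 \<le> ln L" using L3 by simp
  have K2: "2 \<le> K" using lnL by (simp add: K_def)
  have n_eq: "real n = x * L" using L3 by (simp add: x_def)
  have n1: "0 < ln (real n)"
  proof -
    have "1 * 1 < x * L" using x256 L3 by (intro mult_strict_mono) auto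
    then show ?thesis unfolding n_eq by simp
  qed
  have A0: "0 < A_lev \<alpha> n e" using s by (simp add: small_lev_def)
  have ll: "log_lev \<alpha> n e = - ln (A_lev \<alpha> n e)" using A0 by (simp add: log_lev_def ln_div)
  have sx: "16 \<le> sqrt x" using x256 by (intro real_le_rsqrt) auto
  have A: "A_lev \<alpha> n e \<le> 2 * \<epsilon> + 2 / sqrt x"
  proof -
    have "sqrt (L / (2 * real n)) \<le> sqrt (1 / x)"
      using L3 n by (simp add: x_def field_simps)
    then have "sqrt (L / (2 * real n)) \<le> 1 / sqrt x" by (simp add: real_sqrt_divide)
    moreover have "1 / x \<le> 1 / sqrt x"
      using x256 by (intro divide_left_mono real_le_lsqrt) (auto simp: power2_eq_square)
    moreover have "e \<le> 2 * \<epsilon> + 1 / x" using e \<epsilon> L3 n by (auto simp: x_def L_def[symmetric] max_def split: if_splits intro: order_trans)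
    ultimately show ?thesis by (simp add: A_lev_def L_def)
  qed
  have nn: "0 \<le> 1 / sqrt (ln (real n))" "0 \<le> inv_sqrt_log \<epsilon>"
    using n1 \<epsilon> by (auto simp: inv_sqrt_log_def field_simps intro!: divide_nonneg_nonneg ln_ge_zero)
  show ?thesis
  proof (cases "1 / sqrt x \<le> \<epsilon>")
    case True
    have "0 < \<epsilon>" by (rule less_le_trans[OF _ True]) (use x256 in simp)
    have "A_lev \<alpha> n e \<le> 4 * \<epsilon>" using A True by simp
    then have "ln (A_lev \<alpha> n e) \<le> ln (4 * \<epsilon>)" using A0 by (intro ln_mono) auto
    also have "\<dots> \<le> ln (sqrt \<epsilon>)"
    proof -
      have "4 * \<epsilon> \<le> sqrt \<epsilon>" using \<epsilon> \<open>0 < \<epsilon>\<close> by (intro real_le_rsqrt) (auto simp: power2_eq_square)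
      then show ?thesis using \<open>0 < \<epsilon>\<close> by (intro ln_mono) auto
    qed
    also have "\<dots> = - (1 / 2 * ln (1 / \<epsilon>))" using \<open>0 < \<epsilon>\<close> by (simp add: ln_sqrt ln_div)
    finally have ln_A: "ln (A_lev \<alpha> n e) \<le> - (1 / 2 * ln (1 / \<epsilon>))" .
    have l0: "0 < ln (1 / \<epsilon>)" using \<open>0 < \<epsilon>\<close> \<epsilon> by (intro ln_gt_zero) (auto simp: field_simps)
    have l: "ln (1 / \<epsilon>) / 4 \<le> log_lev \<alpha> n e" using ll ln_A l0 by linarith
    have "1 / sqrt (log_lev \<alpha> n e) \<le> 1 / sqrt (ln (1 / \<epsilon>) / 4)"
      using l l0 by (intro divide_left_mono) auto
    also have "\<dots> = 2 * inv_sqrt_log \<epsilon>" using \<open>0 < \<epsilon>\<close> by (simp add: inv_sqrt_log_def real_sqrt_divide)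
    also have "\<dots> \<le> K * (1 / sqrt (ln (real n)) + inv_sqrt_log \<epsilon>)"
      using K2 nn by (intro mult_mono) auto
    finally show ?thesis by (simp add: K_def L_def)
  next
    case False
    have "A_lev \<alpha> n e \<le> 4 / sqrt x" using A False by simp
    then have "ln (A_lev \<alpha> n e) \<le> ln (4 / sqrt x)" using A0 by (intro ln_mono) auto
    moreover have "4 / sqrt x \<le> 1 / sqrt (sqrt x)"
    proof -
      have "4 \<le> sqrt (sqrt x)" using x256 by (intro real_le_rsqrt) simp
      moreover have "sqrt (sqrt x) * sqrt (sqrt x) = sqrt x" using sx by simp
      moreover have "0 < sqrt (sqrt x)" using x256 by simp
      ultimately have "4 * sqrt (sqrt x) \<le> sqrt x"
        using mult_right_mono[of 4 "sqrt (sqrt x)" "sqrt (sqrt x)"] by simp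
      then show ?thesis using x256 \<open>0 < sqrt (sqrt x)\<close>
        by (subst frac_le_eq) (auto simp: divide_le_0_iff)
    qed
    moreover from this have "ln (4 / sqrt x) \<le> ln (1 / sqrt (sqrt x))" using x256 by (intro ln_mono) auto
    moreover have "ln (1 / sqrt (sqrt x)) = - (ln x / 4)" using x256 by (simp add: ln_div ln_sqrt)
    ultimately have l: "ln x / 4 \<le> log_lev \<alpha> n e" using ll by simp
    have lnx: "1 \<le> ln x" 
    proof -
      have "exp 1 \<le> x" using exp_le x256 by linarith
      then show ?thesis using x256 by (subst ln_ge_iff) auto
    qed
    have "ln (real n) = ln x + ln L" using x256 L3 by (simp add: n_eq ln_mult)
    also have "\<dots> \<le> ln x * (1 + ln L)" using mult_right_mono[OF lnx lnL] by (simp add: algebra_simps)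
    finally have "ln (real n) / (1 + ln L) \<le> ln x" using lnL by (simp add: pos_divide_le_eq)
    then have "ln (real n) / (1 + ln L) / 4 \<le> ln x / 4" by (rule divide_right_mono) simp
    also note l
    finally have "ln (real n) / (1 + ln L) / 4 \<le> log_lev \<alpha> n e" .
    moreover have "ln (real n) / (1 + ln L) / 4 = ln (real n) / K\<^sup>2"
      using lnL by (simp add: K_def power_mult_distrib)
    ultimately have l': "ln (real n) / K\<^sup>2 \<le> log_lev \<alpha> n e" by (simp only:)
    have "1 / sqrt (log_lev \<alpha> n e) \<le> 1 / sqrt (ln (real n) / K\<^sup>2)"
      using l' n1 K2 by (intro divide_left_mono mult_pos_pos) (auto intro: less_le_trans[OF _ l'])
    also have "\<dots> = K * (1 / sqrt (ln (real n)))" using K2 by (simp add: real_sqrt_divide)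
    also have "\<dots> \<le> K * (1 / sqrt (ln (real n)) + inv_sqrt_log \<epsilon>)"
      using K2 nn by (intro mult_left_mono) auto
    finally show ?thesis by (simp add: K_def L_def)
  qed
qed

lemma prob_distributions_nonempty: "prob_distributions \<noteq> {}"
proof -
  have "distr (measure_pmf (return_pmf 0)) borel real \<in> prob_distributions"
    by (auto simp: prob_distributions_def intro!: prob_space.prob_space_distr measure_pmf.prob_space_axioms)
  then show ?thesis by auto
qed

lemma CI_hat_guarantees:
  assumes \<alpha>: "0 < \<alpha>" "\<alpha> < 1" and n: "1 \<le> n" and \<epsilon>max: "0 \<le> \<epsilon>max"
    and small: "ln (2 / \<alpha>) / real n + \<epsilon>max \<le> exp (- 4000) / 9"
    and contam: "0 \<le> \<epsilon>" "\<epsilon> \<le> \<epsilon>max" and lam: "0 \<le> lam" and Q: "Q \<in> prob_distributions"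
  defines "C \<equiv> 6 * (2 * sqrt (1 + ln (ln (24 / \<alpha>)))) + 120 * ln (24 / \<alpha>)"
  shows "1 - \<alpha> \<le> \<P>(X in sample_law n \<epsilon> lam Q. lam \<in> CI_hat \<alpha> n \<epsilon>max X)"
    and "1 - \<alpha> \<le> \<P>(X in sample_law n \<epsilon> lam Q.
           interval_length (CI_hat \<alpha> n \<epsilon>max X) \<le> C * length_rate n \<epsilon> lam)"
proof -
  define u where "u = ln (24 / \<alpha>) / real n"
  have exp4000: "4096 \<le> exp (4000 :: real)"
  proof -
    have "4096 \<le> (2001 :: real) * 2001" by simp
    also have "\<dots> \<le> exp 2000 * exp 2000"
      using exp_ge_add_one_self[of 2000] by (intro mult_mono) auto
    also have "\<dots> = exp 4000" by (simp flip: exp_add)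
    finally show ?thesis .
  qed
  have tiny: "exp (- 4000) \<le> (1 / 4096 :: real)" using exp4000 by (simp add: exp_minus field_simps)
  have ln2: "0 < ln (2 / \<alpha>)" using \<alpha> by (simp add: field_simps)
  then have "0 \<le> ln (2 / \<alpha>) / real n" by simp
  then have \<epsilon>max': "\<epsilon>max \<le> exp (- 4000) / 9" and "ln (2 / \<alpha>) / real n \<le> exp (- 4000) / 9"
    using small \<epsilon>max by linarith+
  moreover have "u \<le> 5 * (ln (2 / \<alpha>) / real n)"
    using ln_24_div_le[OF \<alpha>] unfolding u_def by (simp add: divide_right_mono)
  ultimately have u: "u \<le> 5 / 9 * exp (- 4000)" by simp
  interpret contaminated_sample \<alpha> n \<epsilon> lam Q
    using \<alpha> n contam lam Q \<epsilon>max' tiny by unfold_locales auto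
  have L0: "0 < L" using L_ge_3 by simp
  have u0: "0 < u" using L0 n by (simp add: u_def)
  have "4096 \<le> 1 / u"
    using u u0 tiny by (simp add: field_simps)
  then have x: "4096 \<le> real n / L" by (simp add: u_def)
  obtain m :: nat where m: "7 \<le> m" "real m ^ 4 \<le> real n / L" "real n / L \<le> 16 * real m ^ 4"
    by (rule exists_fourth_root_nat[OF x])
  have m0: "0 < m" using m(1) by simp
  have s: "small_lev \<alpha> n e" and adm: "admissible \<alpha> n (2 / real m) e" if "e \<in> eps_grid \<alpha> n \<epsilon>max" for e
  proof -
    note e = eps_grid_bounds[OF \<epsilon>max L0 n that]
    show s: "small_lev \<alpha> n e"
      using e \<epsilon>max' u u0 by (intro small_lev_of_small) (auto simp: u_def)
    show "admissible \<alpha> n (2 / real m) e"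
      by (rule admissible_of_small_lev[OF s e(1) L0 n m0 m(3)])
  qed
  have budget: "2 * (real (m + 1) * exp (- (real n / (4 * (real m)\<^sup>2)))) \<le> \<alpha> / 2"
    by (rule deviation_budget[OF \<alpha>(1) L_ge_3 m(1,2)])
  show "1 - \<alpha> \<le> \<P>(X in sample_law n \<epsilon> lam Q. lam \<in> CI_hat \<alpha> n \<epsilon>max X)"
    by (rule CI_hat_coverage[OF adm m0 budget])
  obtain e where e: "e \<in> eps_grid \<alpha> n \<epsilon>max" "\<epsilon> \<le> e" "e \<le> max (2 * \<epsilon>) (L / real n)"
    by (rule eps_grid_dominates[OF contam L0 n])
  have "1 \<le> 2 * sqrt (1 + ln L)"
  proof -
    have "0 \<le> ln L" using L_ge_3 by simp
    then have "1 \<le> sqrt (1 + ln L)" by simp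
    then show ?thesis by linarith
  qed
  moreover have "1 / sqrt (log_lev \<alpha> n e) \<le> 2 * sqrt (1 + ln L) * (1 / sqrt (ln (real n)) + inv_sqrt_log \<epsilon>)"
    using \<epsilon> \<epsilon>max' tiny x by (intro inverse_sqrt_log_lev_le[OF s[OF e(1)] _ _ L_ge_3 n _ e(3)]) auto
  ultimately show "1 - \<alpha> \<le> \<P>(X in sample_law n \<epsilon> lam Q.
      interval_length (CI_hat \<alpha> n \<epsilon>max X) \<le> C * length_rate n \<epsilon> lam)"
    unfolding C_def by (rule CI_hat_length[OF adm[OF e(1)] m0 budget e(1,2)])
qed

theorem theorem8:
  shows "\<exists>c0 :: real. c0 > 0 \<and>
    (\<forall>\<alpha> :: real. 0 < \<alpha> \<and> \<alpha> < 1 \<longrightarrow>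
      (\<exists>C :: real. C > 0 \<and>
        (\<forall>(n :: nat) (\<epsilon>max :: real).
          1 \<le> n \<and> 0 \<le> \<epsilon>max \<and> \<epsilon>max \<le> 1 \<and> ln (2 / \<alpha>) / real n + \<epsilon>max \<le> c0 \<longrightarrow>
            (INF (\<epsilon>, lam, Q) \<in> {0..\<epsilon>max} \<times> {0..} \<times> prob_distributions.
               \<P>(X in sample_law n \<epsilon> lam Q. lam \<in> CI_hat \<alpha> n \<epsilon>max X)) \<ge> 1 - \<alpha> \<and>
            (INF (\<epsilon>, lam, Q) \<in> {0..\<epsilon>max} \<times> {0..} \<times> prob_distributions.
               \<P>(X in sample_law n \<epsilon> lam Q.
                  interval_length (CI_hat \<alpha> n \<epsilon>max X) \<le> C * length_rate n \<epsilon> lam)) \<ge> 1 - \<alpha>)))"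
proof (rule exI[of _ "exp (- 4000) / 9 :: real"], intro conjI allI impI)
  show "(0 :: real) < exp (- 4000) / 9" by simp
next
  fix \<alpha> :: real assume \<alpha>: "0 < \<alpha> \<and> \<alpha> < 1"
  define C where "C = 6 * (2 * sqrt (1 + ln (ln (24 / \<alpha>)))) + 120 * ln (24 / \<alpha>)"
  have "exp 1 \<le> 24 / \<alpha>" 
  proof -
    have "exp 1 \<le> (3 :: real)" by (rule exp_le)
    also have "\<dots> \<le> 24 / \<alpha>" using \<alpha> by (simp add: field_simps)
    finally show ?thesis .
  qed
  then have "1 \<le> ln (24 / \<alpha>)" using \<alpha> by (subst ln_ge_iff) auto
  then have "0 < C" unfolding C_def by (intro add_nonneg_pos) auto
  moreover have "(INF (\<epsilon>, lam, Q) \<in> {0..\<epsilon>max} \<times> {0..} \<times> prob_distributions.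
         \<P>(X in sample_law n \<epsilon> lam Q. lam \<in> CI_hat \<alpha> n \<epsilon>max X)) \<ge> 1 - \<alpha> \<and>
      (INF (\<epsilon>, lam, Q) \<in> {0..\<epsilon>max} \<times> {0..} \<times> prob_distributions.
         \<P>(X in sample_law n \<epsilon> lam Q.
            interval_length (CI_hat \<alpha> n \<epsilon>max X) \<le> C * length_rate n \<epsilon> lam)) \<ge> 1 - \<alpha>"
    if "1 \<le> n \<and> 0 \<le> \<epsilon>max \<and> \<epsilon>max \<le> 1 \<and> ln (2 / \<alpha>) / real n + \<epsilon>max \<le> exp (- 4000) / 9"
    for n :: nat and \<epsilon>max :: real
  proof -
    have ne: "{0..\<epsilon>max} \<times> {0 :: real..} \<times> prob_distributions \<noteq> {}"
      using that prob_distributions_nonempty by auto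
    show ?thesis
      using that \<alpha> CI_hat_guarantees[of \<alpha> n \<epsilon>max, folded C_def]
      by (intro conjI cINF_greatest[OF ne]) auto
  qed
  ultimately show "\<exists>C > 0. \<forall>(n :: nat) (\<epsilon>max :: real).
          1 \<le> n \<and> 0 \<le> \<epsilon>max \<and> \<epsilon>max \<le> 1 \<and> ln (2 / \<alpha>) / real n + \<epsilon>max \<le> exp (- 4000) / 9 \<longrightarrow>
            (INF (\<epsilon>, lam, Q) \<in> {0..\<epsilon>max} \<times> {0..} \<times> prob_distributions.
               \<P>(X in sample_law n \<epsilon> lam Q. lam \<in> CI_hat \<alpha> n \<epsilon>max X)) \<ge> 1 - \<alpha> \<and>
            (INF (\<epsilon>, lam, Q) \<in> {0..\<epsilon>max} \<times> {0..} \<times> prob_distributions.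
               \<P>(X in sample_law n \<epsilon> lam Q.
                  interval_length (CI_hat \<alpha> n \<epsilon>max X) \<le> C * length_rate n \<epsilon> lam)) \<ge> 1 - \<alpha>"
    by blast
qed

end
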